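(* Let $\rho$ and $\sigma$ be $d$-dimensional quantum states, let $r=\max\{\mathrm{rank}(\rho),\mathrm{rank}(\sigma)\}$, let $\epsilon>0$, let $k,l$ be (large) positive integers, and let $$\widetilde R=\min\left\{r,\left\lceil\ln\left(\frac{4k+4l}{\epsilon}\right)\right\rceil\right\},\qquad k,l>\widetilde R\ge 1 .$$ Let $t$ be an integer with $t\ge\widetilde R$. Then it is possible to approximate all of the values $\mathrm{Tr}(\rho^i\sigma^j)$, $(i,j)\in\{1,\dots,k\}\times\{1,\dots,l\}$, within additive error $\epsilon$, using quantum resources only to estimate the values $$\{\mathrm{Tr}(\rho^i)\}_{i=1}^{t},\qquad \{\mathrm{Tr}(\sigma^i)\}_{i=1}^{t},\qquad \{\mathrm{Tr}(\rho^i\sigma^j)\}_{1\le i\le t,\,1\le j\le t}.$$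
   Context: A $d$-dimensional quantum state is a positive semidefinite complex $d\times d$ matrix of trace $1$. "Using quantum resources only to estimate" a given finite list of values means: there are an accuracy $\eta>0$ and a classical procedure (a function), both depending only on $k,l,\epsilon,t$, such that whenever the procedure is given as input real or complex numbers that approximate each value in the list within additive error $\eta$, it outputs numbers approximating each $\mathrm{Tr}(\rho^i\sigma^j)$, $1\le i\le k$, $1\le j\le l$, within additive error $\epsilon$; the procedure has no other access to $\rho$ and $\sigma$. *)

theory Defs
  imports
    "Jordan_Normal_Form.Schur_Decomposition"
    "Jordan_Normal_Form.DL_Rank"
begin

definition mat_trace :: "'a :: comm_monoid_add mat \<Rightarrow> 'a" where
  "mat_trace A = (\<Sum>i<dim_row A. A $$ (i, i))"

(* The order on complex numbers is that of Complex_Order: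
   0 <= z means that z is real and nonnegative. *)
definition positive_semidefinite :: "nat \<Rightarrow> complex mat \<Rightarrow> bool" where
  "positive_semidefinite d A \<longleftrightarrow>
     A \<in> carrier_mat d d \<and> mat_adjoint A = A \<and>
     (\<forall>v \<in> carrier_vec d. 0 \<le> (A *\<^sub>v v) \<bullet>c v)"

definition quantum_state :: "nat \<Rightarrow> complex mat \<Rightarrow> bool" where
  "quantum_state d \<rho> \<longleftrightarrow> positive_semidefinite d \<rho> \<and> mat_trace \<rho> = 1"

(* Integer-valued because the ceiling can be nonpositive when epsilon is large. *)
definition R_tilde :: "nat \<Rightarrow> nat \<Rightarrow> real \<Rightarrow> nat \<Rightarrow> int" where
  "R_tilde k l \<epsilon> r = min (int r) \<lceil>ln ((4 * real k + 4 * real l) / \<epsilon>)\<rceil>"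

(* A classical procedure.  The arguments are estimates of Tr(rho^i), Tr(sigma^i) and
   Tr(rho^i sigma^j); the result, applied to i and j, is the output for Tr(rho^i sigma^j).
   Arguments are indexed by all of nat, but a statement that constrains them only at the
   indices 1..t and quantifies over all of them gives the procedure nothing beyond these. *)
type_synonym procedure =
  "(nat \<Rightarrow> complex) \<Rightarrow> (nat \<Rightarrow> complex) \<Rightarrow> (nat \<Rightarrow> nat \<Rightarrow> complex) \<Rightarrow> nat \<Rightarrow> nat \<Rightarrow> complex"

end

(* Let p and q be the eigenvalues of rho and sigma and w the doubly stochastic matrix of squared overlaps
   of their eigenvectors, so that Tr(rho^i sigma^j) is the sum of w a b (p a)^i (q b)^j. Newton's
   identities recover from the first t power sums the coefficients c_0, ..., c_t of
   E(z) = prod_a (1 - p_a z), and reducing x^i modulo x (c_0 x^t + ... + c_t) to a combination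
   of x, ..., x^t gives an estimate of Tr(rho^i sigma^j) that is a polynomial in the data, hence
   stable under small errors.

   If the rank is at most t the reduction is exact on the spectrum. Otherwise its error at x = p_a is
   x e(x) times the sum of h_j x^(n-j) over j <= n, where n = i - t - 1, e(x) is up to sign the t-th
   elementary symmetric function of the other eigenvalues, at most (1 - x)^t / t!, and the h_j are
   the coefficients of the inverse of the truncation of E. Since t is at least ln((4k + 4l) / eps),
   the truncation is so good that |h_j| <= 2 for the relevant j. As (1 - x)^t times a
   geometric sum is at most 1, the error is at most 2 x / t!, with no loss in k or l. *)
theory Submission
  imports
    Defs
    "Jordan_Normal_Form.Spectral_Radius"
    "HOL-Computational_Algebra.Formal_Power_Series"
begin

section \<open>Elementary symmetric functions as power series\<close>

text \<open>The m-th coefficient is (-1)^m times the m-th elementary symmetric function of the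
  \<open>p a\<close>. As a power series with constant term 1 it can be inverted, and the inverse
  generates the complete homogeneous symmetric functions.\<close>

definition esym_fps :: "'a set \<Rightarrow> ('a \<Rightarrow> real) \<Rightarrow> real fps" where
  "esym_fps S p = (\<Prod>a\<in>S. 1 - fps_const (p a) * fps_X)"

lemma esym_fps_0 [simp]: "fps_nth (esym_fps S p) 0 = 1"
  by (induction S rule: infinite_finite_induct) (auto simp: esym_fps_def)

lemma esym_fps_insert:
  assumes "finite S" "a \<notin> S"
  shows "esym_fps (insert a S) p = (1 - fps_const (p a) * fps_X) * esym_fps S p"
  using assms by (simp add: esym_fps_def)

lemma esym_fps_insert_nth:
  assumes "finite S" "a \<notin> S"
  shows "fps_nth (esym_fps (insert a S) p) (Suc m)
       = fps_nth (esym_fps S p) (Suc m) - p a * fps_nth (esym_fps S p) m"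
proof -
  have "esym_fps (insert a S) p = esym_fps S p - fps_const (p a) * (fps_X * esym_fps S p)"
    by (simp add: esym_fps_insert[OF assms] algebra_simps)
  then show ?thesis by simp
qed

text \<open>Two terms of a binomial expansion: what the next bound needs when a new variable x joins
  variables of sum s.\<close>

lemma add_power_ge_first_order:
  fixes s x :: real
  assumes "0 \<le> s" "0 \<le> x"
  shows "s ^ Suc m + real (Suc m) * x * s ^ m \<le> (s + x) ^ Suc m"
proof (induction m)
  case (Suc m)
  have "s ^ Suc (Suc m) + real (Suc (Suc m)) * x * s ^ Suc m
      \<le> (s + x) * (s ^ Suc m + real (Suc m) * x * s ^ m)"
    using assms by (simp add: algebra_simps)
  also have "\<dots> \<le> (s + x) * (s + x) ^ Suc m"
    using Suc assms by (intro mult_left_mono) auto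
  finally show ?case by simp
qed auto

text \<open>Expanding \<open>sum p S ^ m\<close> produces each product of m distinct variables m!
  times, besides other nonnegative terms. The induction adds one variable at a time.\<close>

lemma esym_fps_nth_le:
  assumes "finite S" "\<And>a. a \<in> S \<Longrightarrow> 0 \<le> p a"
  shows "\<bar>fps_nth (esym_fps S p) m\<bar> \<le> sum p S ^ m / fact m"
  using assms
proof (induction S arbitrary: m rule: finite_induct)
  case empty
  then show ?case by (cases m) (auto simp: esym_fps_def)
next
  case (insert a S)
  show ?case
  proof (cases m)
    case (Suc n)
    have nn: "0 \<le> sum p S" "0 \<le> p a" using insert.prems by (auto intro: sum_nonneg)
    have "\<bar>fps_nth (esym_fps (insert a S) p) m\<bar>
        \<le> \<bar>fps_nth (esym_fps S p) (Suc n)\<bar> + p a * \<bar>fps_nth (esym_fps S p) n\<bar>"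
      using nn abs_triangle_ineq4[of "fps_nth (esym_fps S p) (Suc n)" "p a * fps_nth (esym_fps S p) n"]
      by (simp add: Suc esym_fps_insert_nth insert.hyps abs_mult)
    also have "\<dots> \<le> sum p S ^ Suc n / fact (Suc n) + p a * (sum p S ^ n / fact n)"
      using nn by (intro add_mono mult_left_mono insert.IH insert.prems) auto
    also have "\<dots> = (sum p S ^ Suc n + real (Suc n) * p a * sum p S ^ n) / fact (Suc n)"
      by (simp add: field_simps del: of_nat_Suc)
    also have "\<dots> \<le> (sum p S + p a) ^ Suc n / fact (Suc n)"
      using add_power_ge_first_order[OF nn, of n] by (intro divide_right_mono) auto
    finally show ?thesis using insert.hyps by (simp add: Suc add.commute)
  qed auto
qed

text \<open>Every product of m distinct variables contains a zero factor. With eigenvalues as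
  variables, this is how the rank enters.\<close>

lemma esym_fps_nth_eq_0:
  assumes "finite S" "card {a\<in>S. p a \<noteq> 0} < m"
  shows "fps_nth (esym_fps S p) m = 0"
  using assms
proof (induction S arbitrary: m rule: finite_induct)
  case empty
  then show ?case by (auto simp: esym_fps_def)
next
  case (insert a S)
  obtain n where m: "m = Suc n" using insert.prems by (cases m) auto
  show ?case
  proof (cases "p a = 0")
    case True
    then have "{b \<in> insert a S. p b \<noteq> 0} = {b\<in>S. p b \<noteq> 0}" by auto
    then show ?thesis using insert True m by (simp add: esym_fps_insert_nth)
  next
    case False
    then have "{b \<in> insert a S. p b \<noteq> 0} = insert a {b\<in>S. p b \<noteq> 0}" by auto
    then have "card {b \<in> insert a S. p b \<noteq> 0} = Suc (card {b\<in>S. p b \<noteq> 0})"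
      using insert.hyps by simp
    then show ?thesis using insert m by (simp add: esym_fps_insert_nth)
  qed
qed

section \<open>Power sums, Newton's identities and complete homogeneous sums\<close>

definition power_sum_fps :: "'a set \<Rightarrow> ('a \<Rightarrow> real) \<Rightarrow> real fps" where
  "power_sum_fps S p = Abs_fps (\<lambda>n. if n = 0 then 0 else \<Sum>a\<in>S. p a ^ n)"

lemma geometric_fps: 
  "(1 - fps_const x * fps_X) * Abs_fps (\<lambda>n. x ^ n) = (1 :: real fps)"
proof (rule fps_ext)
  fix n
  have "(1 - fps_const x * fps_X) * Abs_fps (\<lambda>n. x ^ n)
      = Abs_fps (\<lambda>n. x ^ n) - fps_const x * (fps_X * Abs_fps (\<lambda>n. x ^ n))"
    by (simp add: algebra_simps)
  then show "fps_nth ((1 - fps_const x * fps_X) * Abs_fps (\<lambda>n. x ^ n)) n = fps_nth 1 n"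
    by (cases n) auto
qed

text \<open>With the constant coefficient set to 0, a variable x contributes x z / (1 - x z);
  multiplying by 1 - x z leaves x z.\<close>

lemma power_sum_fps_insert:
  assumes "finite S" "a \<notin> S"
  shows "(1 - fps_const (p a) * fps_X) * power_sum_fps (insert a S) p
       = (1 - fps_const (p a) * fps_X) * power_sum_fps S p + fps_const (p a) * fps_X"
proof -
  have "power_sum_fps (insert a S) p = power_sum_fps S p + Abs_fps (\<lambda>n. p a ^ n) - 1"
    using assms by (intro fps_ext) (simp add: power_sum_fps_def)
  then have "(1 - fps_const (p a) * fps_X) * power_sum_fps (insert a S) p
       = (1 - fps_const (p a) * fps_X) * power_sum_fps S p
       + (1 - fps_const (p a) * fps_X) * Abs_fps (\<lambda>n. p a ^ n) - (1 - fps_const (p a) * fps_X)"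
    by (simp only: distrib_left right_diff_distrib mult_1_right)
  then show ?thesis by (simp add: geometric_fps)
qed

text \<open>This is the logarithmic derivative of a product: z E'(z) / E(z) is the sum of - p_a z /
  (1 - p_a z). Denominators are cleared so that the induction over the factors stays within products
  of series.\<close>

lemma newton_identity_fps:
  assumes "finite S"
  shows "fps_X * fps_deriv (esym_fps S p) = - (esym_fps S p * power_sum_fps S p)"
  using assms
proof (induction S rule: finite_induct)
  case empty
  then show ?case by (simp add: esym_fps_def power_sum_fps_def fps_eq_iff)
next
  case (insert a S)
  let ?l = "1 - fps_const (p a) * fps_X" and ?E = "esym_fps S p" 
  have "fps_X * fps_deriv (?l * ?E) = ?l * (fps_X * fps_deriv ?E) - fps_const (p a) * fps_X * ?E"
    by (simp add: algebra_simps)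
  also have "\<dots> = - (?E * (?l * power_sum_fps S p + fps_const (p a) * fps_X))"
    by (simp only: insert.IH) (simp add: algebra_simps)
  also have "\<dots> = - (?E * (?l * power_sum_fps (insert a S) p))"
    by (simp only: power_sum_fps_insert[OF insert.hyps])
  also have "\<dots> = - (?l * ?E * power_sum_fps (insert a S) p)"
    by (simp only: ac_simps)
  finally show ?case by (simp only: esym_fps_insert[OF insert.hyps])
qed

text \<open>Newton's identities solved for the m-th signed coefficient. Only \<open>P 1\<close>,
  ..., \<open>P m\<close> are read, and P may be any sequence, so noisy estimates can be
  inserted.\<close>

fun newton_coeff :: "(nat \<Rightarrow> real) \<Rightarrow> nat \<Rightarrow> real" where
  "newton_coeff P m = (if m = 0 then 1 else - (\<Sum>i\<in>{1..m}. P i * newton_coeff P (m - i)) / real m)"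

declare newton_coeff.simps [simp del]

lemma newton_coeff_eq_esym:
  assumes "finite S" "\<And>i. 1 \<le> i \<Longrightarrow> i \<le> m \<Longrightarrow> P i = (\<Sum>a\<in>S. p a ^ i)"
  shows "newton_coeff P m = fps_nth (esym_fps S p) m"
  using assms(2)
proof (induction m rule: less_induct)
  case (less m)
  show ?case
  proof (cases m)
    case 0
    then show ?thesis by (simp add: newton_coeff.simps)
  next
    case (Suc n)
    have "real m * fps_nth (esym_fps S p) m = fps_nth (fps_X * fps_deriv (esym_fps S p)) m"
      by (simp add: Suc)
    also have "\<dots> = - fps_nth (power_sum_fps S p * esym_fps S p) m"
      by (simp add: newton_identity_fps[OF assms(1)] mult.commute)
    also have "\<dots> = - (\<Sum>i=0..m. fps_nth (power_sum_fps S p) i * fps_nth (esym_fps S p) (m - i))"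
      by (simp add: fps_mult_nth)
    also have "\<dots> = - (\<Sum>i\<in>{1..m}. fps_nth (power_sum_fps S p) i * fps_nth (esym_fps S p) (m - i))"
      by (simp add: sum.atLeast_Suc_atMost power_sum_fps_def)
    also have "\<dots> = - (\<Sum>i\<in>{1..m}. P i * newton_coeff P (m - i))"
      using less by (intro arg_cong[where f=uminus] sum.cong) (auto simp: power_sum_fps_def)
    finally have "fps_nth (esym_fps S p) m = - (\<Sum>i\<in>{1..m}. P i * newton_coeff P (m - i)) / real m"
      using Suc by (simp add: field_simps)
    then show ?thesis using Suc by (subst newton_coeff.simps) simp
  qed
qed

lemma power_le_self:
  fixes x :: real
  assumes "0 \<le> x" "x \<le> 1" "1 \<le> i"
  shows "x ^ i \<le> x"
  using assms power_decreasing[of 1 i x] by simp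

lemma power_sum_le_1:
  fixes p :: "'a \<Rightarrow> real"
  assumes "finite S" "\<And>a. a \<in> S \<Longrightarrow> 0 \<le> p a" "sum p S \<le> 1" "1 \<le> i"
  shows "\<bar>\<Sum>a\<in>S. p a ^ i\<bar> \<le> 1"
proof -
  have "p a \<le> 1" if "a \<in> S" for a using member_le_sum[of a S p] assms that by simp
  then have "(\<Sum>a\<in>S. p a ^ i) \<le> sum p S"
    using assms by (intro sum_mono power_le_self) auto
  then show ?thesis using assms sum_nonneg[of S "\<lambda>a. p a ^ i"] by simp
qed

text \<open>The coefficients h_n of 1/E satisfy n h_n = P_1 h_(n-1) + ... + P_n h_0. Every power sum
  P_i has absolute value at most 1, so strong induction gives the bound.\<close>

lemma inverse_esym_fps_le_1:
  assumes "finite S" "\<And>a. a \<in> S \<Longrightarrow> 0 \<le> p a" "sum p S \<le> 1"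
  shows "\<bar>fps_nth (inverse (esym_fps S p)) n\<bar> \<le> 1"
proof (induction n rule: less_induct)
  case (less n)
  let ?E = "esym_fps S p" and ?P = "power_sum_fps S p"
  have inv: "inverse ?E * ?E = 1" by (rule inverse_mult_eq_1) simp
  have "fps_X * fps_deriv (inverse ?E) = - (fps_X * fps_deriv ?E) * (inverse ?E)\<^sup>2"
    by (simp add: fps_inverse_deriv algebra_simps)
  also have "\<dots> = ?P * inverse ?E * (inverse ?E * ?E)"
    by (simp add: newton_identity_fps[OF assms(1)] power2_eq_square algebra_simps)
  finally have eq: "fps_X * fps_deriv (inverse ?E) = ?P * inverse ?E" by (simp add: inv)
  have P1: "\<bar>\<Sum>a\<in>S. p a ^ i\<bar> \<le> 1" if "1 \<le> i" for i
    using power_sum_le_1[OF assms that] .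
  show ?case
  proof (cases n)
    case 0
    then show ?thesis by simp
  next
    case (Suc m)
    have "real n * fps_nth (inverse ?E) n = fps_nth (fps_X * fps_deriv (inverse ?E)) n"
      by (simp add: Suc)
    also have "\<dots> = (\<Sum>i=0..n. fps_nth ?P i * fps_nth (inverse ?E) (n - i))"
      by (simp add: eq fps_mult_nth)
    also have "\<dots> = (\<Sum>i\<in>{1..n}. fps_nth ?P i * fps_nth (inverse ?E) (n - i))"
      by (simp add: sum.atLeast_Suc_atMost power_sum_fps_def)
    finally have "real n * \<bar>fps_nth (inverse ?E) n\<bar>
        = \<bar>\<Sum>i\<in>{1..n}. fps_nth ?P i * fps_nth (inverse ?E) (n - i)\<bar>"
      by (metis abs_mult abs_of_nat)
    also have "\<dots> \<le> (\<Sum>i\<in>{1..n}. \<bar>fps_nth ?P i * fps_nth (inverse ?E) (n - i)\<bar>)" by (rule sum_abs)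
    also have "\<dots> \<le> (\<Sum>i\<in>{1..n}. 1)"
      using less P1 by (intro sum_mono) (auto simp: abs_mult power_sum_fps_def intro!: mult_le_one)
    finally show ?thesis using Suc by simp
  qed
qed

section \<open>Reducing high powers to low ones\<close>

text \<open>The recurrence x^i = - (c_1 x^(i-1) + ... + c_t x^(i-t)) is unrolled until the exponent
  is at most t. Since i > t >= s, the exponent i - s never drops to 0.\<close>

fun reduce_coeff :: "nat \<Rightarrow> (nat \<Rightarrow> real) \<Rightarrow> nat \<Rightarrow> nat \<Rightarrow> real" where
  "reduce_coeff t c i m =
     (if i \<le> t then (if i = m then 1 else 0)
      else - (\<Sum>s\<in>{1..t}. c s * reduce_coeff t c (i - s) m))"

declare reduce_coeff.simps [simp del]

text \<open>The polynomial agreeing with \<open>x\<^sup>i\<close> modulo \<open>x (x\<^sup>t + c\<^sub>1 x\<^bsup>t-1\<^esup> + \<dots> + c\<^sub>t)\<close>;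
  it has no constant term, so only the given moments enter.\<close>

definition reduced_power :: "nat \<Rightarrow> (nat \<Rightarrow> real) \<Rightarrow> nat \<Rightarrow> real \<Rightarrow> real" where
  "reduced_power t c i x = (\<Sum>m\<in>{1..t}. reduce_coeff t c i m * x ^ m)"

lemma reduced_power_low:
  assumes "1 \<le> i" "i \<le> t"
  shows "reduced_power t c i x = x ^ i"
proof -
  have "reduced_power t c i x = (\<Sum>m\<in>{1..t}. if m = i then x ^ m else 0)"
    unfolding reduced_power_def using assms
    by (intro sum.cong refl) (auto simp: reduce_coeff.simps)
  then show ?thesis using assms by simp
qed

lemma reduced_power_rec:
  assumes "t < i"
  shows "reduced_power t c i x = - (\<Sum>s\<in>{1..t}. c s * reduced_power t c (i - s) x)"
proof -
  have "reduced_power t c i x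
      = (\<Sum>m\<in>{1..t}. - (\<Sum>s\<in>{1..t}. c s * reduce_coeff t c (i - s) m * x ^ m))"
    unfolding reduced_power_def using assms
    by (intro sum.cong refl, subst reduce_coeff.simps) (simp add: sum_distrib_right)
  also have "\<dots> = - (\<Sum>s\<in>{1..t}. \<Sum>m\<in>{1..t}. c s * reduce_coeff t c (i - s) m * x ^ m)"
    unfolding sum_negf by (subst sum.swap) (rule refl)
  finally show ?thesis by (simp add: reduced_power_def sum_distrib_left mult.assoc)
qed

section \<open>The reduction error through generating functions\<close>

definition trunc_fps :: "nat \<Rightarrow> (nat \<Rightarrow> real) \<Rightarrow> real fps" where
  "trunc_fps t c = Abs_fps (\<lambda>m. if m \<le> t then c m else 0)"

text \<open>The errors d_i vanish for 1 <= i <= t. The truncated series times the generating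
  function of the d_(n+t+1) equals x q / (1 - x z), where q is the value at x of c_0 x^t + ... +
  c_t. Dividing by the truncation gives the formula.\<close>

lemma reduced_power_error:
  assumes "c 0 = 1"
  shows "x ^ (n + t + 1) - reduced_power t c (n + t + 1) x
       = x * (\<Sum>m\<le>t. c m * x ^ (t - m)) *
         (\<Sum>j\<le>n. fps_nth (inverse (trunc_fps t c)) j * x ^ (n - j))"
proof -
  define d where "d i = x ^ i - reduced_power t c i x" for i
  define q where "q = (\<Sum>m\<le>t. c m * x ^ (t - m))"
  let ?E = "trunc_fps t c" and ?G = "Abs_fps (\<lambda>n. d (n + t + 1))"
  let ?X = "Abs_fps (\<lambda>n. x ^ n)"
  have d0: "d i = 0" if "1 \<le> i" "i \<le> t" for i
    using that by (simp add: d_def reduced_power_low)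
  have "?E * ?G = fps_const (x * q) * ?X"
  proof (rule fps_ext)
    fix n
    have low: "{..t} = insert 0 {1..t}" by auto
    have "fps_nth (?E * ?G) n = (\<Sum>m\<in>{0..n}. fps_nth ?E m * d (n + t + 1 - m))"
      by (auto simp: fps_mult_nth Suc_diff_le intro!: sum.cong)
    \<comment> \<open>For n < m <= n + t the index n + t + 1 - m lies between 1 and t, where the
      error vanishes.\<close>
    also have "\<dots> = (\<Sum>m\<in>{0..n+t}. fps_nth ?E m * d (n + t + 1 - m))"
      by (intro sum.mono_neutral_left) (auto intro!: d0)
    also have "\<dots> = (\<Sum>m\<in>{..t}. fps_nth ?E m * d (n + t + 1 - m))"
      by (intro sum.mono_neutral_right) (auto simp: trunc_fps_def)
    also have "\<dots> = (\<Sum>m\<le>t. c m * x ^ (n + t + 1 - m))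
        - (\<Sum>m\<le>t. c m * reduced_power t c (n + t + 1 - m) x)"
      by (simp add: trunc_fps_def d_def right_diff_distrib sum_subtractf)
    also have "(\<Sum>m\<le>t. c m * reduced_power t c (n + t + 1 - m) x) = 0"
      unfolding low using reduced_power_rec[of t "n + t + 1" c x] by (simp add: assms)
    also have "(\<Sum>m\<le>t. c m * x ^ (n + t + 1 - m)) = (\<Sum>m\<le>t. c m * (x ^ (t - m) * x ^ Suc n))"
    proof (intro sum.cong refl)
      fix m assume "m \<in> {..t}"
      then have "n + t + 1 - m = t - m + Suc n" by simp
      then show "c m * x ^ (n + t + 1 - m) = c m * (x ^ (t - m) * x ^ Suc n)"
        by (simp only: power_add)
    qed
    also have "\<dots> = q * x ^ Suc n"
      by (simp add: q_def sum_distrib_right mult.assoc)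
    finally show "fps_nth (?E * ?G) n = fps_nth (fps_const (x * q) * ?X) n" by simp
  qed
  moreover have "inverse ?E * ?E = 1"
    by (rule inverse_mult_eq_1) (simp add: trunc_fps_def assms)
  ultimately have "?G = fps_const (x * q) * (inverse ?E * ?X)"
    by (metis (no_types, lifting) mult.assoc mult.left_commute mult_1)
  then have "fps_nth ?G n = fps_nth (fps_const (x * q) * (inverse ?E * ?X)) n" by (rule arg_cong)
  also have "\<dots> = x * q * fps_nth (inverse ?E * ?X) n" by simp
  finally show ?thesis
    by (simp add: d_def q_def fps_mult_nth atLeast0AtMost)
qed

text \<open>Telescoping: with f(n) = 1 / (n! n), the term 1 / (n+1)! is at most f(n) -
  f(n+1).\<close>

lemma inverse_fact_tail_le:
  assumes "1 \<le> t"
  shows "(\<Sum>i\<in>{t<..m}. 1 / fact i) \<le> 1 / (fact t * real t)"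
proof -
  have "(\<Sum>i\<in>{t<..m}. 1 / fact i) \<le> 1 / (fact t * real t) - 1 / (fact m * real m)" if "t \<le> m"
    using that
  proof (induction m rule: dec_induct)
    case (step n)
    have "1 / fact (Suc n) \<le> 1 / (fact n * real n) - 1 / (fact (Suc n) * real (Suc n))"
    proof -
      have n: "0 < real n" using assms step by simp
      have "1 / (1 + real n) + 1 / ((1 + real n) * (1 + real n)) \<le> 1 / real n"
        using n by (simp add: divide_simps) (simp add: algebra_simps)
      then have "(1 / (1 + real n) + 1 / ((1 + real n) * (1 + real n))) / fact n \<le> 1 / real n / fact n"
        by (rule divide_right_mono) simp
      then show ?thesis by (simp add: add_divide_distrib ac_simps)
    qed
    moreover have "{t<..Suc n} = insert (Suc n) {t<..n}" using step by auto
    ultimately show ?case using step by simp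
  qed auto
  then show ?thesis
    by (cases "t \<le> m") (auto intro: order_trans)
qed

text \<open>The tail of the series is a small perturbation, so that the inverse of the truncation obeys a
  renewal equation whose kernel has mass at most 1/2 on the relevant range.\<close>

lemma inverse_trunc_fps_le_2:
  assumes "fps_nth E 0 = 1" "\<And>n. \<bar>fps_nth (inverse E) n\<bar> \<le> 1" "\<And>m. \<bar>fps_nth E m\<bar> \<le> 1 / fact m"
    and "1 \<le> t" "real N / (fact t * real t) \<le> 1 / 2" "n \<le> N"
  shows "\<bar>fps_nth (inverse (trunc_fps t (fps_nth E))) n\<bar> \<le> 2"
proof -
  define \<tau> where "\<tau> = 1 / (fact t * real t)"
  let ?K = "inverse (trunc_fps t (fps_nth E))" and ?H = "inverse E"
  let ?R = "E - trunc_fps t (fps_nth E)"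
  have \<tau>: "0 \<le> \<tau>" "real N * \<tau> \<le> 1 / 2" using assms(5) by (auto simp: \<tau>_def)
  have "?H * E = 1" by (rule inverse_mult_eq_1) (simp add: assms)
  moreover have "?K * trunc_fps t (fps_nth E) = 1"
    by (rule inverse_mult_eq_1) (simp add: trunc_fps_def assms)
  moreover have "?R * ?H * ?K = (?H * E) * ?K - (?K * trunc_fps t (fps_nth E)) * ?H"
    by (simp add: algebra_simps)
  \<comment> \<open>With R the tail of E, H = 1/E and K the inverse of the truncation, K - H = R H
    K, because R is the difference of the two denominators.\<close>
  ultimately have K: "?K = ?H + (?R * ?H) * ?K" by simp
  have T: "\<bar>fps_nth (?R * ?H) m\<bar> \<le> \<tau>" for m
  proof -
    have "\<bar>fps_nth (?R * ?H) m\<bar> \<le> (\<Sum>i=0..m. \<bar>fps_nth ?R i * fps_nth ?H (m - i)\<bar>)"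
      unfolding fps_mult_nth by (rule sum_abs)
    also have "\<dots> \<le> (\<Sum>i=0..m. if i \<le> t then 0 else 1 / fact i)"
      unfolding abs_mult
    proof (intro sum_mono)
      fix i
      show "\<bar>fps_nth ?R i\<bar> * \<bar>fps_nth ?H (m - i)\<bar> \<le> (if i \<le> t then 0 else 1 / fact i)"
        using mult_mono[OF assms(3)[of i] assms(2)[of "m - i"]] by (simp add: trunc_fps_def)
    qed
    also have "\<dots> = (\<Sum>i\<in>{t<..m}. 1 / fact i)"
      by (intro sum.mono_neutral_cong_right) auto
    also have "\<dots> \<le> \<tau>" unfolding \<tau>_def by (rule inverse_fact_tail_le) fact
    finally show ?thesis .
  qed
  have T0: "fps_nth (?R * ?H) 0 = 0" by (simp add: trunc_fps_def)
  show ?thesis using assms(6)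
  proof (induction n rule: less_induct)
    case (less n)
    have "fps_nth ?K n = fps_nth (?H + (?R * ?H) * ?K) n" using K by (rule arg_cong)
    also have "\<dots> = fps_nth ?H n + fps_nth ((?R * ?H) * ?K) n" by simp
    \<comment> \<open>The kernel has no constant term, so coefficient n depends only on earlier ones
      and strong induction applies.\<close>
    also have "fps_nth ((?R * ?H) * ?K) n
        = (\<Sum>i\<in>{1..n}. fps_nth (?R * ?H) i * fps_nth ?K (n - i))"
      unfolding fps_mult_nth[of "?R * ?H"] using T0 by (simp add: sum.atLeast_Suc_atMost)
    finally have "\<bar>fps_nth ?K n\<bar>
        \<le> \<bar>fps_nth ?H n\<bar> + \<bar>\<Sum>i\<in>{1..n}. fps_nth (?R * ?H) i * fps_nth ?K (n - i)\<bar>"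
      using abs_triangle_ineq by metis
    also have "\<dots> \<le> 1 + (\<Sum>i\<in>{1..n}. \<bar>fps_nth (?R * ?H) i * fps_nth ?K (n - i)\<bar>)"
      by (intro add_mono assms(2) sum_abs)
    also have "\<dots> \<le> 1 + (\<Sum>i\<in>{1..n}. \<tau> * 2)"
      unfolding abs_mult using less \<tau>(1) T by (intro add_mono sum_mono mult_mono order_refl) auto
    also have "\<dots> \<le> 1 + real N * \<tau> * 2"
      using less.prems \<tau>(1) by (simp add: mult_left_mono)
    also have "\<dots> \<le> 2" using \<tau>(2) by simp
    finally show ?case .
  qed
qed

text \<open>Multiplying by the geometric series 1 / (1 - p_a z) removes the factor of a from E; the
  left side is the t-th coefficient of that product.\<close>

lemma esym_fps_reduced_root:
  assumes "finite S" "a \<in> S"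
  shows "(\<Sum>m\<le>t. fps_nth (esym_fps S p) m * p a ^ (t - m)) = fps_nth (esym_fps (S - {a}) p) t"
proof -
  have "esym_fps S p * Abs_fps (\<lambda>n. p a ^ n)
      = esym_fps (S - {a}) p * ((1 - fps_const (p a) * fps_X) * Abs_fps (\<lambda>n. p a ^ n))"
    using esym_fps_insert[of "S - {a}" a p] assms by (simp add: insert_absorb ac_simps)
  then have "fps_nth (esym_fps S p * Abs_fps (\<lambda>n. p a ^ n)) t = fps_nth (esym_fps (S - {a}) p) t"
    by (simp add: geometric_fps)
  then show ?thesis by (simp add: fps_mult_nth atLeast0AtMost)
qed

text \<open>The error has as factors x and the t-th coefficient for the remaining variables. If x =
  \<open>p a\<close> is nonzero, fewer than t of the others are nonzero and the second factor
  vanishes; otherwise the first does.\<close>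

lemma reduced_power_exact:
  assumes "finite S" "a \<in> S" "card {a\<in>S. p a \<noteq> 0} \<le> t" "1 \<le> i"
  shows "reduced_power t (fps_nth (esym_fps S p)) i (p a) = p a ^ i"
proof (cases "i \<le> t")
  case True
  then show ?thesis using assms by (simp add: reduced_power_low)
next
  case False
  then obtain n where i: "i = n + t + 1" by (metis add.commute add.left_commute less_natE not_le Suc_eq_plus1)
  have "p a = 0 \<or> fps_nth (esym_fps (S - {a}) p) t = 0"
  proof (cases "p a = 0")
    case False
    have "card {b \<in> S - {a}. p b \<noteq> 0} < card {a\<in>S. p a \<noteq> 0}"
      using assms False by (intro psubset_card_mono) auto
    then show ?thesis using assms by (intro disjI2 esym_fps_nth_eq_0) auto
  qed auto
  then show ?thesis
    using reduced_power_error[of "fps_nth (esym_fps S p)" "p a" n t] assms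
    by (auto simp: i esym_fps_reduced_root)
qed

text \<open>One factor 1 - x collapses the geometric sum to 1 - x^(n+1); the other t - 1 factors are
  at most 1.\<close>

lemma power_mult_geometric_le_1:
  fixes x :: real
  assumes "0 \<le> x" "x \<le> 1" "1 \<le> t"
  shows "(1 - x) ^ t * (\<Sum>j\<le>n. x ^ j) \<le> 1"
proof -
  have "(1 - x) ^ t * (\<Sum>j\<le>n. x ^ j) \<le> (1 - x) * (\<Sum>j\<le>n. x ^ j)"
    using assms power_decreasing[of 1 t "1 - x"] by (intro mult_right_mono sum_nonneg) auto
  also have "\<dots> = 1 - x ^ Suc n" by (simp only: lessThan_Suc_atMost[symmetric] one_diff_power_eq)
  also have "\<dots> \<le> 1" using assms by simp
  finally show ?thesis .
qed

text \<open>The bound keeps a factor \<open>p a\<close>, so that its sum over the spectrum is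
  independent of the dimension.\<close>

lemma reduced_power_error_le:
  assumes "finite S" "a \<in> S" "\<And>a. a \<in> S \<Longrightarrow> 0 \<le> p a" "sum p S = 1"
    and "1 \<le> t" "real N / (fact t * real t) \<le> 1 / 2" "1 \<le> i" "i \<le> N"
  shows "\<bar>p a ^ i - reduced_power t (fps_nth (esym_fps S p)) i (p a)\<bar> \<le> 2 * p a / fact t"
proof (cases "i \<le> t")
  case True
  then show ?thesis using assms by (simp add: reduced_power_low)
next
  case False
  then obtain n where i: "i = n + t + 1" by (metis add.commute add.left_commute less_natE not_le Suc_eq_plus1)
  define K where "K = inverse (trunc_fps t (fps_nth (esym_fps S p)))"
  have pa: "0 \<le> p a" "p a \<le> 1" using member_le_sum[of a S p] assms by auto
  \<comment> \<open>The other variables have total mass 1 - p_a, which yields the power (1 - p_a)^t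
    that pays for the geometric sum below.\<close>
  have "sum p (S - {a}) = 1 - p a" using assms by (simp add: sum_diff1)
  then have q: "\<bar>fps_nth (esym_fps (S - {a}) p) t\<bar> \<le> (1 - p a) ^ t / fact t"
    using esym_fps_nth_le[of "S - {a}" p t] assms by simp
  have "\<bar>\<Sum>j\<le>n. fps_nth K j * p a ^ (n - j)\<bar> \<le> (\<Sum>j\<le>n. 2 * p a ^ (n - j))"
  proof (intro order_trans[OF sum_abs] sum_mono)
    fix j assume "j \<in> {..n}"
    then have "\<bar>fps_nth K j\<bar> \<le> 2" unfolding K_def using assms i
      by (intro inverse_trunc_fps_le_2[where N = N] inverse_esym_fps_le_1
            order_trans[OF esym_fps_nth_le]) auto
    then show "\<bar>fps_nth K j * p a ^ (n - j)\<bar> \<le> 2 * p a ^ (n - j)"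
      using pa by (simp add: abs_mult mult_right_mono)
  qed
  also have "\<dots> = 2 * (\<Sum>j\<le>n. p a ^ j)"
    using sum.nat_diff_reindex[of "\<lambda>j. p a ^ j" "Suc n"]
    by (simp add: sum_distrib_left[symmetric] lessThan_Suc_atMost)
  finally have g: "\<bar>\<Sum>j\<le>n. fps_nth K j * p a ^ (n - j)\<bar> \<le> 2 * (\<Sum>j\<le>n. p a ^ j)" .
  have "\<bar>p a ^ i - reduced_power t (fps_nth (esym_fps S p)) i (p a)\<bar>
      = p a * (\<bar>fps_nth (esym_fps (S - {a}) p) t\<bar> * \<bar>\<Sum>j\<le>n. fps_nth K j * p a ^ (n - j)\<bar>)"
    using reduced_power_error[of "fps_nth (esym_fps S p)" "p a" n t] assms pa
    by (simp add: i esym_fps_reduced_root K_def abs_mult)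
  also have "\<dots> \<le> p a * ((1 - p a) ^ t / fact t * (2 * (\<Sum>j\<le>n. p a ^ j)))"
    using pa q g by (intro mult_left_mono mult_mono) auto
  also have "\<dots> = 2 * p a / fact t * ((1 - p a) ^ t * (\<Sum>j\<le>n. p a ^ j))" by simp
  also have "\<dots> \<le> 2 * p a / fact t * 1"
    using pa assms by (intro mult_left_mono power_mult_geometric_le_1) auto
  finally show ?thesis by simp
qed

section \<open>The estimator and its stability\<close>

text \<open>Stability is argued along sequences instead of with explicit moduli: u is the perturbed
  and v the exact quantity. The relation is preserved by sums and products, hence by every fixed
  polynomial expression.\<close>

definition close_seq :: "(nat \<Rightarrow> real) \<Rightarrow> (nat \<Rightarrow> real) \<Rightarrow> bool" where
  "close_seq u v \<longleftrightarrow> (\<exists>B. \<forall>n. \<bar>v n\<bar> \<le> B) \<and> (\<lambda>n. u n - v n) \<longlonglongrightarrow> 0"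

lemma close_seq_const: "close_seq (\<lambda>_. x) (\<lambda>_. x)"
  by (auto simp: close_seq_def)

lemma close_seq_add:
  assumes "close_seq u v" "close_seq u' v'"
  shows "close_seq (\<lambda>n. u n + u' n) (\<lambda>n. v n + v' n)"
proof -
  obtain B B' where "\<And>n. \<bar>v n\<bar> \<le> B" "\<And>n. \<bar>v' n\<bar> \<le> B'"
    using assms by (auto simp: close_seq_def)
  then have "\<bar>v n + v' n\<bar> \<le> B + B'" for n
    by (meson abs_triangle_ineq add_mono order_trans)
  moreover have "(\<lambda>n. (u n - v n) + (u' n - v' n)) \<longlonglongrightarrow> 0 + 0"
    using assms by (intro tendsto_add) (auto simp: close_seq_def)
  ultimately show ?thesis by (auto simp: close_seq_def algebra_simps)
qed

lemma close_seq_mult: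
  assumes "close_seq u v" "close_seq u' v'"
  shows "close_seq (\<lambda>n. u n * u' n) (\<lambda>n. v n * v' n)"
proof -
  obtain B B' where B: "\<And>n. \<bar>v n\<bar> \<le> B" "\<And>n. \<bar>v' n\<bar> \<le> B'"
    using assms by (auto simp: close_seq_def)
  have d: "(\<lambda>n. u n - v n) \<longlonglongrightarrow> 0" "(\<lambda>n. u' n - v' n) \<longlonglongrightarrow> 0"
    using assms by (auto simp: close_seq_def)
  have "\<bar>v n * v' n\<bar> \<le> B * B'" for n
    unfolding abs_mult using B[of n] by (intro mult_mono) auto
  moreover have "(\<lambda>n. (u n - v n) * v' n) \<longlonglongrightarrow> 0"
    using B by (intro tendsto_0_le[OF d(1), of _ B'])
      (auto intro!: always_eventually mult_left_mono simp: abs_mult)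
  moreover have "(\<lambda>n. (u' n - v' n) * v n) \<longlonglongrightarrow> 0"
    using B by (intro tendsto_0_le[OF d(2), of _ B])
      (auto intro!: always_eventually mult_left_mono simp: abs_mult)
  moreover have "(\<lambda>n. (u n - v n) * (u' n - v' n)) \<longlonglongrightarrow> 0"
    using tendsto_mult[OF d] by simp
  ultimately have "(\<lambda>n. (u n - v n) * v' n + (u' n - v' n) * v n + (u n - v n) * (u' n - v' n))
      \<longlonglongrightarrow> 0 + 0 + 0" by (intro tendsto_add)
  moreover have "(\<lambda>n. (u n - v n) * v' n + (u' n - v' n) * v n + (u n - v n) * (u' n - v' n))
      = (\<lambda>n. u n * u' n - v n * v' n)" by (auto simp: algebra_simps)
  ultimately show ?thesis
    using \<open>\<And>n. \<bar>v n * v' n\<bar> \<le> B * B'\<close> by (auto simp: close_seq_def)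
qed

lemma close_seq_sum:
  assumes "finite I" "\<And>i. i \<in> I \<Longrightarrow> close_seq (u i) (v i)"
  shows "close_seq (\<lambda>n. \<Sum>i\<in>I. u i n) (\<lambda>n. \<Sum>i\<in>I. v i n)"
  using assms by (induction I rule: finite_induct) (auto intro: close_seq_const close_seq_add)

lemma close_seq_newton_coeff:
  assumes "\<And>i. i \<in> {1..m} \<Longrightarrow> close_seq (\<lambda>n. P n i) (\<lambda>n. P' n i)"
  shows "close_seq (\<lambda>n. newton_coeff (P n) m) (\<lambda>n. newton_coeff (P' n) m)"
  using assms
proof (induction m rule: less_induct)
  case (less m)
  show ?case
  proof (cases "m = 0")
    case True
    then show ?thesis by (simp add: newton_coeff.simps close_seq_const)
  next
    case False
    have "close_seq (\<lambda>n. - 1 / real m * (\<Sum>i\<in>{1..m}. P n i * newton_coeff (P n) (m - i)))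
        (\<lambda>n. - 1 / real m * (\<Sum>i\<in>{1..m}. P' n i * newton_coeff (P' n) (m - i)))"
      using less by (intro close_seq_mult close_seq_const close_seq_sum) auto
    then show ?thesis
      using False by (subst (1 2) newton_coeff.simps) simp
  qed
qed

lemma close_seq_reduce_coeff:
  assumes "\<And>s. s \<in> {1..t} \<Longrightarrow> close_seq (\<lambda>n. c n s) (\<lambda>n. c' n s)"
  shows "close_seq (\<lambda>n. reduce_coeff t (c n) i m) (\<lambda>n. reduce_coeff t (c' n) i m)"
proof (induction i rule: less_induct)
  case (less i)
  show ?case
  proof (cases "i \<le> t")
    case True
    then show ?thesis by (simp add: reduce_coeff.simps close_seq_const)
  next
    case False
    have "close_seq (\<lambda>n. - 1 * (\<Sum>s\<in>{1..t}. c n s * reduce_coeff t (c n) (i - s) m))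
        (\<lambda>n. - 1 * (\<Sum>s\<in>{1..t}. c' n s * reduce_coeff t (c' n) (i - s) m))"
      using less False assms by (intro close_seq_mult close_seq_const close_seq_sum) auto
    then show ?thesis
      using False by (subst (1 2) reduce_coeff.simps) simp
  qed
qed

lemma reduce_coeff_cong:
  assumes "\<And>s. s \<in> {1..t} \<Longrightarrow> c s = c' s"
  shows "reduce_coeff t c i m = reduce_coeff t c' i m"
proof (induction i rule: less_induct)
  case (less i)
  then show ?case using assms by (subst (1 2) reduce_coeff.simps) (auto intro!: sum.cong)
qed

text \<open>Both powers are replaced by their reductions, with coefficients computed from the data,
  and the trace is expanded bilinearly. As m and n run over 1..t, only the given moments are
  read.\<close>

definition moment_estimate ::
  "nat \<Rightarrow> (nat \<Rightarrow> real) \<Rightarrow> (nat \<Rightarrow> real) \<Rightarrow> (nat \<Rightarrow> nat \<Rightarrow> real) \<Rightarrow> nat \<Rightarrow> nat \<Rightarrow> real" where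
  "moment_estimate t P Q C i j = (\<Sum>m\<in>{1..t}. \<Sum>n\<in>{1..t}.
     reduce_coeff t (newton_coeff P) i m * reduce_coeff t (newton_coeff Q) j n * C m n)"

text \<open>The estimate is a fixed polynomial in the data. If no tolerance worked, the choices
  1/(N+1) would give counterexamples forming close sequences, whose estimates would be close as
  well. The tolerance depends only on t, I, J and \<delta>, so it is uniform in the
  dimension.\<close>

lemma moment_estimate_stable:
  fixes I J :: "nat set"
  assumes "finite I" "finite J" "0 < \<delta>"
  shows "\<exists>\<eta>>0. \<forall>P Q C P' Q' C'.
    (\<forall>m\<in>{1..t}. \<bar>P' m\<bar> \<le> 1 \<and> \<bar>Q' m\<bar> \<le> 1 \<and> \<bar>P m - P' m\<bar> \<le> \<eta> \<and> \<bar>Q m - Q' m\<bar> \<le> \<eta>) \<longrightarrow>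
    (\<forall>m\<in>{1..t}. \<forall>n\<in>{1..t}. \<bar>C' m n\<bar> \<le> 1 \<and> \<bar>C m n - C' m n\<bar> \<le> \<eta>) \<longrightarrow>
    (\<forall>i\<in>I. \<forall>j\<in>J. \<bar>moment_estimate t P Q C i j - moment_estimate t P' Q' C' i j\<bar> < \<delta>)"
proof (rule ccontr)
  assume contr: "\<not> ?thesis"
  have "\<exists>P Q C P' Q' C'.
    (\<forall>m\<in>{1..t}. \<bar>P' m\<bar> \<le> 1 \<and> \<bar>Q' m\<bar> \<le> 1
       \<and> \<bar>P m - P' m\<bar> \<le> 1 / real (Suc N) \<and> \<bar>Q m - Q' m\<bar> \<le> 1 / real (Suc N)) \<and>
    (\<forall>m\<in>{1..t}. \<forall>n\<in>{1..t}. \<bar>C' m n\<bar> \<le> 1 \<and> \<bar>C m n - C' m n\<bar> \<le> 1 / real (Suc N)) \<and>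
    \<not> (\<forall>i\<in>I. \<forall>j\<in>J. \<bar>moment_estimate t P Q C i j - moment_estimate t P' Q' C' i j\<bar> < \<delta>)" for N
  proof -
    have "0 < 1 / real (Suc N)" by simp
    then show ?thesis using contr by blast
  qed
  then obtain P Q C P' Q' C' where
    PQ: "\<And>N m. m \<in> {1..t} \<Longrightarrow> \<bar>P' N m\<bar> \<le> 1 \<and> \<bar>Q' N m\<bar> \<le> 1
       \<and> \<bar>P N m - P' N m\<bar> \<le> 1 / real (Suc N) \<and> \<bar>Q N m - Q' N m\<bar> \<le> 1 / real (Suc N)"
    and C: "\<And>N m n. m \<in> {1..t} \<Longrightarrow> n \<in> {1..t} \<Longrightarrow>
       \<bar>C' N m n\<bar> \<le> 1 \<and> \<bar>C N m n - C' N m n\<bar> \<le> 1 / real (Suc N)"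
    and far: "\<And>N. \<not> (\<forall>i\<in>I. \<forall>j\<in>J. \<bar>moment_estimate t (P N) (Q N) (C N) i j
         - moment_estimate t (P' N) (Q' N) (C' N) i j\<bar> < \<delta>)"
    by metis
  have closeI: "close_seq u v"
    if "\<And>n. \<bar>v n\<bar> \<le> 1" "\<And>n. \<bar>u n - v n\<bar> \<le> 1 / real (Suc n)" for u v :: "nat \<Rightarrow> real"
  proof -
    have "(\<lambda>n. u n - v n) \<longlonglongrightarrow> 0"
      using that(2) by (intro tendsto_0_le[OF LIMSEQ_inverse_real_of_nat, of _ 1])
        (auto simp: inverse_eq_divide)
    then show ?thesis using that(1) by (auto simp: close_seq_def)
  qed
  have "close_seq (\<lambda>N. moment_estimate t (P N) (Q N) (C N) i j)
      (\<lambda>N. moment_estimate t (P' N) (Q' N) (C' N) i j)" for i j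
    unfolding moment_estimate_def using PQ C
    by (intro close_seq_sum close_seq_mult close_seq_reduce_coeff close_seq_newton_coeff closeI) auto
  then have "(\<lambda>N. moment_estimate t (P N) (Q N) (C N) i j
      - moment_estimate t (P' N) (Q' N) (C' N) i j) \<longlonglongrightarrow> 0" for i j
    by (simp add: close_seq_def)
  then have "\<forall>\<^sub>F N in sequentially. \<bar>moment_estimate t (P N) (Q N) (C N) i j
      - moment_estimate t (P' N) (Q' N) (C' N) i j\<bar> < \<delta>" for i j
    using assms(3) by (auto simp: tendsto_iff dist_real_def)
  then have "\<forall>\<^sub>F N in sequentially. \<forall>i\<in>I. \<forall>j\<in>J. \<bar>moment_estimate t (P N) (Q N) (C N) i j
      - moment_estimate t (P' N) (Q' N) (C' N) i j\<bar> < \<delta>"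
    using assms by (simp add: eventually_ball_finite)
  then show False using far by (auto simp: eventually_sequentially)
qed

text \<open>Errors proportional to \<open>p a\<close> or to \<open>q b\<close> keep their total mass
  when averaged with w, because w is doubly stochastic. Each first-order term costs \<tau>, and the
  product of the two errors costs \<tau> squared.\<close>

lemma weighted_product_error:
  fixes w :: "'a \<Rightarrow> 'b \<Rightarrow> real"
  assumes "finite S" "finite T" "0 \<le> \<tau>"
    and w: "\<And>a b. 0 \<le> w a b" "\<And>a. a \<in> S \<Longrightarrow> (\<Sum>b\<in>T. w a b) = 1" "\<And>b. b \<in> T \<Longrightarrow> (\<Sum>a\<in>S. w a b) = 1"
    and p: "\<And>a. a \<in> S \<Longrightarrow> 0 \<le> p a" "sum p S = 1"
    and q: "\<And>b. b \<in> T \<Longrightarrow> 0 \<le> q b" "sum q T = 1"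
    and x: "\<And>a. a \<in> S \<Longrightarrow> \<bar>x a\<bar> \<le> 1" "\<And>a. a \<in> S \<Longrightarrow> \<bar>x a - x' a\<bar> \<le> \<tau> * p a"
    and y: "\<And>b. b \<in> T \<Longrightarrow> \<bar>y b\<bar> \<le> 1" "\<And>b. b \<in> T \<Longrightarrow> \<bar>y b - y' b\<bar> \<le> \<tau> * q b"
  shows "\<bar>(\<Sum>a\<in>S. \<Sum>b\<in>T. w a b * x' a * y' b) - (\<Sum>a\<in>S. \<Sum>b\<in>T. w a b * x a * y b)\<bar> \<le> 2 * \<tau> + \<tau>\<^sup>2"
proof -
  have q1: "q b \<le> 1" if "b \<in> T" for b using member_le_sum[of b T q] assms that by simp
  have "\<bar>(\<Sum>a\<in>S. \<Sum>b\<in>T. w a b * x' a * y' b) - (\<Sum>a\<in>S. \<Sum>b\<in>T. w a b * x a * y b)\<bar>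
      = \<bar>\<Sum>a\<in>S. \<Sum>b\<in>T. w a b * (x' a * y' b - x a * y b)\<bar>"
    by (simp add: sum_subtractf algebra_simps)
  also have "\<dots> \<le> (\<Sum>a\<in>S. \<Sum>b\<in>T. \<bar>w a b * (x' a * y' b - x a * y b)\<bar>)"
    by (intro order_trans[OF sum_abs] sum_mono sum_abs)
  also have "\<dots> \<le> (\<Sum>a\<in>S. \<Sum>b\<in>T. w a b * (\<tau> * q b + (\<tau> + \<tau>\<^sup>2) * p a))"
  proof (intro sum_mono)
    fix a b assume a: "a \<in> S" and b: "b \<in> T"
    have "x' a * y' b - x a * y b
        = x a * (y' b - y b) + (x' a - x a) * y b + (x' a - x a) * (y' b - y b)"
      by (simp add: algebra_simps)
    then have "\<bar>x' a * y' b - x a * y b\<bar>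
        \<le> \<bar>x a\<bar> * \<bar>y' b - y b\<bar> + \<bar>x' a - x a\<bar> * \<bar>y b\<bar> + \<bar>x' a - x a\<bar> * \<bar>y' b - y b\<bar>"
      by (simp only: abs_mult[symmetric])
    \<comment> \<open>In the quadratic term one error is bounded by \<tau> p_a and the other by
      \<tau>, using q_b <= 1, so that this term too sums through p.\<close>
    also have "\<dots> \<le> 1 * (\<tau> * q b) + (\<tau> * p a) * 1 + (\<tau> * p a) * (\<tau> * 1)"
    proof (intro add_mono mult_mono)
      show "\<bar>y' b - y b\<bar> \<le> \<tau> * 1"
        using y(2)[OF b] mult_left_mono[OF q1[OF b] assms(3)] by linarith
    qed (use x y p q a b assms(3) in \<open>auto simp: abs_minus_commute\<close>)
    also have "\<dots> = \<tau> * q b + (\<tau> + \<tau>\<^sup>2) * p a" by (simp add: algebra_simps power2_eq_square)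
    finally show "\<bar>w a b * (x' a * y' b - x a * y b)\<bar> \<le> w a b * (\<tau> * q b + (\<tau> + \<tau>\<^sup>2) * p a)"
      using w(1) by (simp add: abs_mult mult_left_mono)
  qed
  also have "\<dots> = (\<Sum>a\<in>S. \<Sum>b\<in>T. \<tau> * q b * w a b) + (\<Sum>a\<in>S. \<Sum>b\<in>T. (\<tau> + \<tau>\<^sup>2) * p a * w a b)"
    unfolding sum.distrib[symmetric] by (intro sum.cong refl) (simp add: algebra_simps)
  also have "(\<Sum>a\<in>S. \<Sum>b\<in>T. \<tau> * q b * w a b) = (\<Sum>b\<in>T. \<tau> * q b)"
    by (subst sum.swap) (simp add: sum_distrib_left[symmetric] w)
  also have "\<dots> = \<tau>" by (simp add: sum_distrib_left[symmetric] q)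
  also have "(\<Sum>a\<in>S. \<Sum>b\<in>T. (\<tau> + \<tau>\<^sup>2) * p a * w a b) = (\<Sum>a\<in>S. (\<tau> + \<tau>\<^sup>2) * p a)"
    by (simp add: sum_distrib_left[symmetric] w)
  also have "\<dots> = \<tau> + \<tau>\<^sup>2" by (simp add: sum_distrib_left[symmetric] p)
  finally show ?thesis by simp
qed

text \<open>On exact data Newton's recursion returns the coefficients of the two generating
  polynomials; the rest exchanges finite sums.\<close>

lemma moment_estimate_eq:
  fixes w :: "'a \<Rightarrow> 'b \<Rightarrow> real"
  assumes "finite S" "finite T"
  shows "moment_estimate t (\<lambda>i. \<Sum>a\<in>S. p a ^ i) (\<lambda>i. \<Sum>b\<in>T. q b ^ i)
      (\<lambda>i j. \<Sum>a\<in>S. \<Sum>b\<in>T. w a b * p a ^ i * q b ^ j) i j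
    = (\<Sum>a\<in>S. \<Sum>b\<in>T. w a b * reduced_power t (fps_nth (esym_fps S p)) i (p a)
         * reduced_power t (fps_nth (esym_fps T q)) j (q b))"
proof -
  have A: "reduce_coeff t (newton_coeff (\<lambda>i. \<Sum>a\<in>X. r a ^ i)) i m
      = reduce_coeff t (fps_nth (esym_fps X r)) i m" if "finite X" for X :: "'c set" and r i m
    using that by (intro reduce_coeff_cong newton_coeff_eq_esym) auto
  let ?\<alpha> = "reduce_coeff t (fps_nth (esym_fps S p)) i" and ?\<beta> = "reduce_coeff t (fps_nth (esym_fps T q)) j"
  have "(\<Sum>m\<in>{1..t}. \<Sum>n\<in>{1..t}. ?\<alpha> m * ?\<beta> n * (\<Sum>a\<in>S. \<Sum>b\<in>T. w a b * p a ^ m * q b ^ n))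
      = (\<Sum>m\<in>{1..t}. \<Sum>n\<in>{1..t}. \<Sum>a\<in>S. \<Sum>b\<in>T. w a b * (?\<alpha> m * p a ^ m) * (?\<beta> n * q b ^ n))"
    by (simp add: sum_distrib_left ac_simps)
  also have "\<dots> = (\<Sum>m\<in>{1..t}. \<Sum>a\<in>S. \<Sum>b\<in>T. \<Sum>n\<in>{1..t}. w a b * (?\<alpha> m * p a ^ m) * (?\<beta> n * q b ^ n))"
    by (subst sum.swap[of _ S "{1..t}"], subst sum.swap[of _ T "{1..t}"]) (rule refl)
  also have "\<dots> = (\<Sum>a\<in>S. \<Sum>b\<in>T. \<Sum>m\<in>{1..t}. \<Sum>n\<in>{1..t}. w a b * (?\<alpha> m * p a ^ m) * (?\<beta> n * q b ^ n))"
    by (subst sum.swap[of _ S "{1..t}"], subst sum.swap[of _ T "{1..t}"]) (rule refl)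
  also have "\<dots> = (\<Sum>a\<in>S. \<Sum>b\<in>T. w a b * reduced_power t (fps_nth (esym_fps S p)) i (p a)
         * reduced_power t (fps_nth (esym_fps T q)) j (q b))"
    by (simp only: reduced_power_def mult.assoc sum_product) (simp only: sum_distrib_left mult.assoc)
  finally show ?thesis
    unfolding moment_estimate_def by (simp only: A[OF assms(1)] A[OF assms(2)])
qed

section \<open>Constants obtained from the lower bound on t\<close>

lemma exp_le_fact:
  assumes "3 \<le> t"
  shows "exp (real t) \<le> 9 / 2 * fact t"
  using assms
proof (induction t rule: dec_induct)
  case base
  \<comment> \<open>The constant 9/2 is 27 / 3!, from e <= 3. Each further step multiplies the left
    side by at most 3 and the right side by n + 1 >= 4.\<close>
  have "exp (real 3) = exp 1 ^ 3" by (simp flip: exp_of_nat_mult)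
  also have "\<dots> \<le> (3::real) ^ 3" by (intro power_mono exp_le) auto
  finally show ?case by (simp add: fact_numeral)
next
  case (step n)
  have "exp (real (Suc n)) = exp (real n) * exp 1" by (simp add: exp_add[symmetric] add.commute)
  also have "\<dots> \<le> (9 / 2 * fact n) * 3" using step exp_le by (intro mult_mono) auto
  also have "\<dots> \<le> 9 / 2 * fact (Suc n)" using step by (simp add: field_simps)
  finally show ?case .
qed

text \<open>The chain (4k + 4l) / \<epsilon> <= e^t <= 9/2 t! bounds the factorial from below. This
  gives the tail condition with N = k + l and keeps the spectral error within 3/4 \<epsilon>,
  leaving a quarter for noisy data.\<close>

lemma truncation_order_bounds:
  fixes \<epsilon> :: real and k l t :: nat
  defines "L \<equiv> \<lceil>ln ((4 * real k + 4 * real l) / \<epsilon>)\<rceil>"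
  assumes "0 < \<epsilon>" "\<epsilon> < 1" "1 \<le> L" "L < int k" "L < int l" "L \<le> int t"
  shows "1 \<le> t" "real (k + l) / (fact t * real t) \<le> 1 / 2"
    "2 * (2 / fact t) + (2 / fact t)\<^sup>2 \<le> 3 / 4 * \<epsilon>"
proof -
  define x where "x = (4 * real k + 4 * real l) / \<epsilon>"
  \<comment> \<open>Bootstrapping: L >= 1 first gives k, l >= 2, so the argument of the logarithm is
    at least 16 > 9 >= e^2. Hence L >= 3, which improves the bounds to t >= 3 and k, l >= 4.\<close>
  have kl2: "2 \<le> k" "2 \<le> l" using assms(4-6) by linarith+
  have "16 \<le> 16 / \<epsilon>" using assms by (simp add: field_simps)
  also have "\<dots> \<le> x" unfolding x_def using kl2 assms(2) by (intro divide_right_mono) auto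
  finally have x: "16 \<le> x" .
  have "exp (2::real) = exp 1 ^ 2" by (simp flip: exp_of_nat_mult)
  also have "\<dots> \<le> (3::real) ^ 2" by (intro power_mono exp_le) auto
  also have "\<dots> < x" using x by simp
  finally have "2 < ln x" using x ln_less_cancel_iff[of "exp 2" x] by simp
  then have L3: "3 \<le> L" unfolding L_def x_def[symmetric] by linarith
  then have t: "3 \<le> t" and kl4: "4 \<le> k" "4 \<le> l" using assms(5-7) by linarith+
  have "ln x \<le> real t" using assms(7) unfolding L_def x_def[symmetric] by linarith
  then have "exp (ln x) \<le> exp (real t)" by simp
  then have "x \<le> exp (real t)" using x by simp
  also have "\<dots> \<le> 9 / 2 * fact t" by (rule exp_le_fact[OF t])
  finally have "(4 * real k + 4 * real l) / \<epsilon> \<le> 9 / 2 * fact t" by (simp only: x_def)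
  then have kl: "8 * (real k + real l) \<le> 9 * \<epsilon> * fact t"
    using assms(2) by (simp add: field_simps)
  define f where "f = (fact t :: real)"
  have f: "0 < f" by (simp add: f_def)
  show "1 \<le> t" using t by simp
  have "2 * (real k + real l) \<le> f * 3"
  proof -
    have "9 * \<epsilon> * f \<le> 9 * f" using assms f by (simp add: mult_le_cancel_right1)
    then show ?thesis using kl f unfolding f_def[symmetric] by linarith
  qed
  also have "\<dots> \<le> f * real t" using t f by (intro mult_left_mono) auto
  finally show "real (k + l) / (fact t * real t) \<le> 1 / 2"
    using f t unfolding f_def[symmetric] by (simp add: field_simps)
  \<comment> \<open>Now k + l >= 8 gives 1 / t! <= 9/64 \<epsilon>, and t! >= 6 absorbs the square:
    the total is at most (4 + 2/3) (9/64) \<epsilon>.\<close>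
  have "4 \<le> real k" "4 \<le> real l" using kl4 by simp_all
  then have "64 \<le> 8 * (real k + real l)" by simp
  then have "64 \<le> 9 * \<epsilon> * f" using kl unfolding f_def by (rule order_trans)
  then have u: "1 / f \<le> 9 / 64 * \<epsilon>" using f by (simp add: field_simps)
  have "f \<ge> 6" using fact_mono[OF t, where 'a = real] by (simp add: f_def fact_numeral)
  then have "1 / f \<le> 1 / 6" using f by (simp add: field_simps)
  then have "(1 / f) * (1 / f) \<le> 1 / 6 * (1 / f)" using f by (intro mult_right_mono) auto
  then have "2 * (2 / f) + (2 / f)\<^sup>2 \<le> (4 + 4 / 6) * (1 / f)"
    by (simp add: power2_eq_square)
  also have "\<dots> \<le> (4 + 4 / 6) * (9 / 64 * \<epsilon>)" by (intro mult_left_mono u) auto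
  also have "\<dots> \<le> 3 / 4 * \<epsilon>" using assms(2) by simp
  finally show "2 * (2 / fact t) + (2 / fact t)\<^sup>2 \<le> 3 / 4 * \<epsilon>" by (simp add: f_def)
qed

section \<open>Spectral decomposition of quantum states\<close>

lemma mat_adjoint_mat:
  "mat_adjoint A = mat (dim_col A) (dim_row A) (\<lambda>(i, j). conjugate (A $$ (j, i)))"
  by (rule eq_matI) (auto simp: mat_adjoint_def mat_of_rows_def)

lemma mat_adjoint_carrier [simp]:
  "A \<in> carrier_mat n m \<Longrightarrow> mat_adjoint A \<in> carrier_mat m n"
  by (simp add: mat_adjoint_mat)

lemma mat_adjoint_dim [simp]:
  "dim_row (mat_adjoint A) = dim_col A" "dim_col (mat_adjoint A) = dim_row A"
  by (simp_all add: mat_adjoint_mat)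

lemma mat_adjoint_index:
  "i < dim_col A \<Longrightarrow> j < dim_row A \<Longrightarrow> mat_adjoint A $$ (i, j) = conjugate (A $$ (j, i))"
  by (simp add: mat_adjoint_mat)

lemma mat_mult_index_sum:
  assumes "A \<in> carrier_mat n m" "B \<in> carrier_mat m k" "i < n" "j < k"
  shows "(A * B) $$ (i, j) = (\<Sum>l<m. A $$ (i, l) * B $$ (l, j))"
  using assms by (auto simp: scalar_prod_def atLeast0LessThan intro!: sum.cong)

lemma mat_adjoint_mult:
  fixes A B :: "complex mat"
  assumes "A \<in> carrier_mat n m" "B \<in> carrier_mat m k"
  shows "mat_adjoint (A * B) = mat_adjoint B * mat_adjoint A"
proof (rule eq_matI)
  fix i j assume "i < dim_row (mat_adjoint B * mat_adjoint A)" "j < dim_col (mat_adjoint B * mat_adjoint A)"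
  then have ij: "i < k" "j < n" using assms by auto
  then show "mat_adjoint (A * B) $$ (i, j) = (mat_adjoint B * mat_adjoint A) $$ (i, j)"
    using assms
    by (auto simp: mat_adjoint_index mat_mult_index_sum[of _ k m _ n] mat_mult_index_sum[of _ n m _ k]
        mult.commute simp del: index_mult_mat(1) intro!: sum.cong)
qed (use assms in auto)

lemma mat_adjoint_adjoint [simp]: "mat_adjoint (mat_adjoint A) = (A :: complex mat)"
  by (rule eq_matI) (auto simp: mat_adjoint_index)

text \<open>A block diagonal embedding, used to pass from dimension n to n + 1 in the
  diagonalization.\<close>

definition lift_mat :: "nat \<Rightarrow> 'a :: zero \<Rightarrow> 'a mat \<Rightarrow> 'a mat" where
  "lift_mat n x A = mat (Suc n) (Suc n)
     (\<lambda>(i, j). case (i, j) of (0, 0) \<Rightarrow> x | (Suc i, Suc j) \<Rightarrow> A $$ (i, j) | _ \<Rightarrow> 0)"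

lemma lift_mat_carrier [simp]: "lift_mat n x A \<in> carrier_mat (Suc n) (Suc n)"
  by (simp add: lift_mat_def)

lemma lift_mat_dim [simp]: "dim_row (lift_mat n x A) = Suc n" "dim_col (lift_mat n x A) = Suc n"
  by (simp_all add: lift_mat_def)

lemma lift_mat_mult:
  fixes A B :: "'a :: comm_semiring_0 mat"
  assumes "A \<in> carrier_mat n n" "B \<in> carrier_mat n n"
  shows "lift_mat n x A * lift_mat n y B = lift_mat n (x * y) (A * B)"
proof (rule eq_matI)
  fix i j assume "i < dim_row (lift_mat n (x * y) (A * B))" "j < dim_col (lift_mat n (x * y) (A * B))"
  then have ij: "i < Suc n" "j < Suc n" by auto
  then show "(lift_mat n x A * lift_mat n y B) $$ (i, j) = lift_mat n (x * y) (A * B) $$ (i, j)"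
    by (subst mat_mult_index_sum[of _ "Suc n" "Suc n" _ "Suc n"])
      (auto simp: lift_mat_def sum.lessThan_Suc_shift mat_mult_index_sum[OF assms]
        simp del: sum.lessThan_Suc index_mult_mat(1) split: nat.splits)
qed auto

lemma lift_mat_adjoint:
  fixes A :: "complex mat"
  assumes "A \<in> carrier_mat n n"
  shows "mat_adjoint (lift_mat n x A) = lift_mat n (cnj x) (mat_adjoint A)"
  using assms by (intro eq_matI) (auto simp: mat_adjoint_index lift_mat_def split: nat.splits)

lemma lift_mat_one: "lift_mat n 1 (1\<^sub>m n) = 1\<^sub>m (Suc n)"
  by (rule eq_matI) (auto simp: lift_mat_def split: nat.splits)

lemma lift_mat_diag: "lift_mat n x (mat_diag n f) = mat_diag (Suc n) (case_nat x f)"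
  by (rule eq_matI) (auto simp: lift_mat_def mat_diag_def split: nat.splits)

text \<open>Complete v to a basis, orthogonalise by Gram-Schmidt, which leaves the first vector
  unchanged, and normalise the columns.\<close>

lemma nonzero_vec_extends_to_unitary:
  fixes v :: "complex vec"
  assumes "v \<in> carrier_vec n" "v \<noteq> 0\<^sub>v n"
  shows "\<exists>W \<in> carrier_mat n n. mat_adjoint W * W = 1\<^sub>m n \<and> (\<exists>s. col W 0 = s \<cdot>\<^sub>v v)"
proof -
  interpret cof_vec_space n "TYPE(complex)" .
  have n: "0 < n" using assms by (cases n) auto
  define b where "b = basis_completion v"
  define ws where "ws = gram_schmidt n b"
  note basis = basis_completion[OF assms, folded b_def]
  then obtain vs where bv: "b = v # vs" using n by (cases b) auto
  have ws: "set ws \<subseteq> carrier_vec n" "corthogonal ws" "length ws = n"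
    using gram_schmidt_result[OF basis(2,4,5) refl, folded ws_def] basis by auto
  have "hd ws = v" using gram_schmidt_hd[OF assms(1), of vs, folded bv] by (simp add: ws_def)
  then have hd_ws: "ws ! 0 = v" using ws(3) n by (cases ws) auto
  define s where "s i = complex_of_real (1 / sqrt (Re (ws ! i \<bullet>c ws ! i)))" for i
  define W where "W = mat n n (\<lambda>(i, j). s j * (ws ! j) $ i)"
  have wsc: "ws ! i \<in> carrier_vec n" if "i < n" for i using ws that by auto
  have "(mat_adjoint W * W) $$ (i, j) = 1\<^sub>m n $$ (i, j)" if ij: "i < n" "j < n" for i j
  proof -
    have "(mat_adjoint W * W) $$ (i, j) = (\<Sum>l<n. s i * s j * ((ws ! j) $ l * cnj ((ws ! i) $ l)))"
      using ij by (subst mat_mult_index_sum[of _ n n _ n])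
        (auto simp: W_def mat_adjoint_index s_def intro!: sum.cong)
    also have "\<dots> = s i * s j * (ws ! j \<bullet>c ws ! i)"
      using wsc[OF ij(1)] wsc[OF ij(2)]
      by (auto simp: scalar_prod_def sum_distrib_left atLeast0LessThan intro!: sum.cong)
    also have "\<dots> = (if i = j then 1 else 0)"
    proof (cases "i = j")
      case True
      define z where "z = ws ! i \<bullet>c ws ! i"
      have "z \<noteq> 0" using corthogonalD[OF ws(2), of i i] ij ws by (auto simp: z_def)
      moreover have "0 \<le> z" unfolding z_def by (rule conjugate_square_ge_0_vec)
      ultimately have "0 < Re z" "Im z = 0" by (auto simp: less_eq_complex_def complex_eq_iff)
      then have "s i * s i * z = 1"
        by (simp add: s_def z_def[symmetric] complex_eq_iff field_simps flip: of_real_mult)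
      then show ?thesis using True by (simp add: z_def)
    next
      case False
      then have "ws ! j \<bullet>c ws ! i = 0" using corthogonalD[OF ws(2), of j i] ij ws by auto
      then show ?thesis using False by simp
    qed
    finally show ?thesis using ij by simp
  qed
  then have "mat_adjoint W * W = 1\<^sub>m n" by (intro eq_matI) (auto simp: W_def)
  moreover have "col W 0 = s 0 \<cdot>\<^sub>v v"
    using hd_ws ws n assms(1) by (intro eq_vecI) (auto simp: W_def)
  ultimately show ?thesis by (intro bexI[of _ W]) (auto simp: W_def)
qed

lemma unitary_right:
  fixes U :: "complex mat"
  assumes "U \<in> carrier_mat n n" "mat_adjoint U * U = 1\<^sub>m n"
  shows "U * mat_adjoint U = 1\<^sub>m n"
  using mat_mult_left_right_inverse[OF _ assms(1) assms(2)] assms by simp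

text \<open>Functional calculus in the basis given by the columns of U: for unitary U, sums and
  products of such matrices correspond to pointwise sums and products of the functions f.\<close>

definition diag_in :: "nat \<Rightarrow> complex mat \<Rightarrow> (nat \<Rightarrow> complex) \<Rightarrow> complex mat" where
  "diag_in n U f = U * mat_diag n f * mat_adjoint U"

text \<open>Deflation: in a unitary basis whose first vector is proportional to an eigenvector, the
  first column is (e, 0, ..., 0), and self-adjointness clears the first row as well. The remaining
  block is Hermitian of size n and is handled by induction.\<close>

theorem hermitian_diagonalization:
  fixes A :: "complex mat"
  assumes "A \<in> carrier_mat n n" "mat_adjoint A = A"
  shows "\<exists>U e. U \<in> carrier_mat n n \<and> mat_adjoint U * U = 1\<^sub>m n \<and> A = diag_in n U e"
  using assms
proof (induction n arbitrary: A)
  case 0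
  then show ?case by (intro exI[of _ "1\<^sub>m 0"] exI[of _ "\<lambda>_. 0"]) (auto simp: diag_in_def intro!: eq_matI)
next
  case (Suc n)
  note A = Suc.prems(1)
  obtain e where "e \<in> spectrum A" using spectrum_non_empty[OF A] by auto
  then obtain v where "eigenvector A v e" by (auto simp: spectrum_def eigenvalue_def)
  then have v: "v \<in> carrier_vec (Suc n)" "v \<noteq> 0\<^sub>v (Suc n)" "A *\<^sub>v v = e \<cdot>\<^sub>v v"
    using A by (auto simp: eigenvector_def)
  obtain W s where W: "W \<in> carrier_mat (Suc n) (Suc n)" "mat_adjoint W * W = 1\<^sub>m (Suc n)"
    and W0: "col W 0 = s \<cdot>\<^sub>v v"
    using nonzero_vec_extends_to_unitary[OF v(1,2)] by auto
  note Wr = unitary_right[OF W]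
  define B where "B = mat_adjoint W * A * W"
  have W': "mat_adjoint W \<in> carrier_mat (Suc n) (Suc n)" using W by simp
  have B: "B \<in> carrier_mat (Suc n) (Suc n)" 
    unfolding B_def using A W W' by (intro mult_carrier_mat)
  note assoc = assoc_mult_mat[of _ "Suc n" "Suc n" _ "Suc n" _ "Suc n"]
    mult_carrier_mat[of _ "Suc n" "Suc n" _ "Suc n"]
  have B_adj: "mat_adjoint B = B"
    using A W Suc.prems(2) by (simp add: B_def mat_adjoint_mult[of _ "Suc n" "Suc n" _ "Suc n"] assoc)
  have "W * B * mat_adjoint W = (W * mat_adjoint W) * A * (W * mat_adjoint W)"
    using A W by (simp add: B_def assoc)
  then have A_eq: "A = W * B * mat_adjoint W" using A by (simp add: Wr)
  \<comment> \<open>Column 0 of A W is e times column 0 of W, and the adjoint of W sends the latter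
    to the first unit vector.\<close>
  have Bi0: "B $$ (i, 0) = (if i = 0 then e else 0)" if i: "i < Suc n" for i
  proof -
    have "A *\<^sub>v col W 0 = e \<cdot>\<^sub>v col W 0"
      using A v by (simp add: W0 mult_mat_vec[OF A v(1)] smult_smult_assoc mult.commute)
    moreover have "col (A * W) 0 = A *\<^sub>v col W 0" using A W(1) by (intro col_mult2) auto
    ultimately have c: "col (A * W) 0 = e \<cdot>\<^sub>v col W 0" by (rule trans[rotated])
    have "B $$ (i, 0) = row (mat_adjoint W) i \<bullet> col (A * W) 0"
      using i A W by (simp add: B_def assoc)
    also have "\<dots> = e * (row (mat_adjoint W) i \<bullet> col W 0)"
      using i W unfolding c by (intro scalar_prod_smult_right) auto
    also have "row (mat_adjoint W) i \<bullet> col W 0 = (mat_adjoint W * W) $$ (i, 0)"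
      using i W(1) by simp
    also have "\<dots> = (if i = 0 then 1 else 0)" unfolding W(2) using i by simp
    finally show ?thesis by simp
  qed
  have B0j: "B $$ (0, j) = (if j = 0 then e else 0)" if j: "j < Suc n" for j
  proof (cases "j = 0")
    case False
    have "B $$ (0, j) = mat_adjoint B $$ (0, j)" by (simp add: B_adj)
    also have "\<dots> = cnj (B $$ (j, 0))" using B j by (simp add: mat_adjoint_index)
    finally show ?thesis using Bi0 j False by simp
  qed (use Bi0 in auto)
  define C where "C = mat n n (\<lambda>(i, j). B $$ (Suc i, Suc j))"
  have C: "C \<in> carrier_mat n n" by (simp add: C_def)
  have "mat_adjoint C = C"
  proof (rule eq_matI)
    fix i j assume "i < dim_row C" "j < dim_col C"
    then have ij: "i < n" "j < n" by (auto simp: C_def)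
    have "B $$ (Suc i, Suc j) = mat_adjoint B $$ (Suc i, Suc j)" by (simp add: B_adj)
    also have "\<dots> = cnj (B $$ (Suc j, Suc i))" using B ij by (simp add: mat_adjoint_index)
    finally show "mat_adjoint C $$ (i, j) = C $$ (i, j)"
      using ij by (simp add: C_def mat_adjoint_index)
  qed (auto simp: C_def)
  from Suc.IH[OF C this] obtain V f where V: "V \<in> carrier_mat n n" "mat_adjoint V * V = 1\<^sub>m n"
    and C_eq: "C = V * mat_diag n f * mat_adjoint V" by (auto simp: diag_in_def)
  define U where "U = lift_mat n 1 V"
  have U: "U \<in> carrier_mat (Suc n) (Suc n)" by (simp add: U_def)
  have U_adj: "mat_adjoint U = lift_mat n 1 (mat_adjoint V)"
    by (simp add: U_def lift_mat_adjoint[OF V(1)])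
  have UU: "mat_adjoint U * U = 1\<^sub>m (Suc n)"
    using V by (simp add: U_adj) (simp add: U_def lift_mat_mult lift_mat_one)
  have "B = lift_mat n e C"
    using B Bi0 B0j by (intro eq_matI) (auto simp: lift_mat_def C_def split: nat.splits)
  also have "\<dots> = U * mat_diag (Suc n) (case_nat e f) * mat_adjoint U"
    unfolding U_adj unfolding U_def lift_mat_diag[symmetric] C_eq
    using V by (simp add: lift_mat_mult[of _ n])
  finally have B_eq: "B = U * mat_diag (Suc n) (case_nat e f) * mat_adjoint U" .
  have D: "mat_diag (Suc n) (case_nat e f) \<in> carrier_mat (Suc n) (Suc n)" by simp
  have adj: "mat_adjoint (W * U) = mat_adjoint U * mat_adjoint W"
    using W U by (simp add: mat_adjoint_mult[of _ "Suc n" "Suc n" _ "Suc n"])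
  have "mat_adjoint (W * U) * (W * U) = mat_adjoint U * ((mat_adjoint W * W) * U)"
    using W(1) U unfolding adj by (simp add: assoc)
  then have 1: "mat_adjoint (W * U) * (W * U) = 1\<^sub>m (Suc n)"
    using U by (simp add: W UU)
  have 2: "A = diag_in (Suc n) (W * U) (case_nat e f)"
    unfolding diag_in_def adj using W U D by (subst A_eq, subst B_eq) (simp add: assoc)
  show ?case using 1 2 W U by (intro exI[of _ "W * U"] exI[of _ "case_nat e f"]) auto
qed

section \<open>Calculus and traces of diagonalized matrices\<close>

lemma diag_in_carrier [simp]:
  "U \<in> carrier_mat n n \<Longrightarrow> diag_in n U f \<in> carrier_mat n n"
  unfolding diag_in_def by (intro mult_carrier_mat[of _ n n]) auto

lemma diag_in_dim [simp]:
  "U \<in> carrier_mat n n \<Longrightarrow> dim_row (diag_in n U f) = n"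
  "U \<in> carrier_mat n n \<Longrightarrow> dim_col (diag_in n U f) = n"
  by (simp_all add: carrier_matD[OF diag_in_carrier])

lemma diag_in_index:
  assumes "U \<in> carrier_mat n n" "i < n" "j < n"
  shows "diag_in n U f $$ (i, j) = (\<Sum>a<n. U $$ (i, a) * f a * cnj (U $$ (j, a)))"
proof -
  have "U * mat_diag n f = mat n n (\<lambda>(i, j). U $$ (i, j) * f j)"
    using assms by (rule_tac mat_diag_mult_right)
  then show ?thesis
    using assms unfolding diag_in_def
    by (subst mat_mult_index_sum[of _ n n _ n]) (auto simp: mat_adjoint_index)
qed

lemma diag_in_mult:
  assumes "U \<in> carrier_mat n n" "mat_adjoint U * U = 1\<^sub>m n"
  shows "diag_in n U f * diag_in n U g = diag_in n U (\<lambda>a. f a * g a)"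
proof -
  note assoc = assoc_mult_mat[of _ n n _ n _ n] mult_carrier_mat[of _ n n _ n]
  have U': "mat_adjoint U \<in> carrier_mat n n" using assms by simp
  have "diag_in n U f * diag_in n U g
      = U * (mat_diag n f * ((mat_adjoint U * U) * (mat_diag n g * mat_adjoint U)))"
    unfolding diag_in_def using assms(1) U' by (simp add: assoc)
  also have "\<dots> = U * (mat_diag n f * (mat_diag n g * mat_adjoint U))"
    unfolding assms(2) using U' by (subst left_mult_one_mat[of _ n n]) (auto simp: assoc)
  also have "\<dots> = U * (mat_diag n f * mat_diag n g) * mat_adjoint U"
    using assms(1) U' by (simp add: assoc del: mat_diag_diag)
  finally show ?thesis by (simp add: diag_in_def)
qed

lemma diag_in_one:
  assumes "U \<in> carrier_mat n n" "mat_adjoint U * U = 1\<^sub>m n"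
  shows "diag_in n U (\<lambda>_. 1) = 1\<^sub>m n"
  using assms unitary_right[OF assms] by (simp add: diag_in_def)

lemma diag_in_pow:
  assumes "U \<in> carrier_mat n n" "mat_adjoint U * U = 1\<^sub>m n"
  shows "diag_in n U f ^\<^sub>m i = diag_in n U (\<lambda>a. f a ^ i)"
  using assms by (induction i) (simp_all add: diag_in_one diag_in_mult mult.commute)

lemma diag_in_cong:
  "(\<And>a. a < n \<Longrightarrow> f a = g a) \<Longrightarrow> diag_in n U f = diag_in n U g"
  unfolding diag_in_def mat_diag_def by (auto intro!: arg_cong2[where f = "(*)"] eq_matI)

lemma diag_in_add:
  assumes "U \<in> carrier_mat n n"
  shows "diag_in n U f + diag_in n U g = diag_in n U (\<lambda>a. f a + g a)"
  using assms by (intro eq_matI) (simp_all add: diag_in_index sum.distrib algebra_simps)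

lemma mat_trace_comm:
  fixes A B :: "complex mat"
  assumes "A \<in> carrier_mat n m" "B \<in> carrier_mat m n"
  shows "mat_trace (A * B) = mat_trace (B * A)"
proof -
  have "mat_trace (A * B) = (\<Sum>i<n. \<Sum>l<m. A $$ (i, l) * B $$ (l, i))"
    using assms by (auto simp: mat_trace_def mat_mult_index_sum[of _ n m _ n] simp del: index_mult_mat(1))
  also have "\<dots> = (\<Sum>l<m. \<Sum>i<n. B $$ (l, i) * A $$ (i, l))"
    by (subst sum.swap) (simp add: mult.commute)
  also have "\<dots> = mat_trace (B * A)"
    using assms by (auto simp: mat_trace_def mat_mult_index_sum[of _ m n _ m] simp del: index_mult_mat(1))
  finally show ?thesis .
qed

text \<open>Cyclicity of the trace merges the outer unitaries into the overlap matrix M, the adjoint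
  of U times V. In the resulting double sum each entry of M meets its own conjugate.\<close>

lemma mat_trace_diag_in_mult:
  assumes "U \<in> carrier_mat n n" "V \<in> carrier_mat n n"
  shows "mat_trace (diag_in n U f * diag_in n V g)
       = (\<Sum>a<n. \<Sum>b<n. f a * g b * of_real ((cmod ((mat_adjoint U * V) $$ (a, b)))\<^sup>2))"
proof -
  note assoc = assoc_mult_mat[of _ n n _ n _ n] mult_carrier_mat[of _ n n _ n]
  define M where "M = mat_adjoint U * V"
  have U': "mat_adjoint U \<in> carrier_mat n n" and V': "mat_adjoint V \<in> carrier_mat n n"
    and M: "M \<in> carrier_mat n n" using assms by (simp_all add: M_def assoc)
  have M': "mat_adjoint M = mat_adjoint V * U" "mat_adjoint M \<in> carrier_mat n n"
    using assms M by (simp_all add: M_def mat_adjoint_mult[of _ n n _ n] assoc)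
  have "mat_trace (diag_in n U f * diag_in n V g)
      = mat_trace (U * (mat_diag n f * (M * (mat_diag n g * mat_adjoint V))))"
    unfolding diag_in_def M_def using assms U' V' by (simp add: assoc)
  also have "\<dots> = mat_trace ((mat_diag n f * (M * (mat_diag n g * mat_adjoint V))) * U)"
    using assms M V' by (intro mat_trace_comm[of _ n n]) (auto intro!: mult_carrier_mat[of _ n n])
  also have "\<dots> = mat_trace ((mat_diag n f * M) * (mat_diag n g * mat_adjoint M))"
    unfolding M'(1) using assms M V' by (simp add: assoc)
  also have "\<dots> = (\<Sum>a<n. \<Sum>b<n. (f a * M $$ (a, b)) * (g b * cnj (M $$ (a, b))))"
    unfolding mat_diag_mult_left[OF M] mat_diag_mult_left[OF M'(2)] mat_trace_def
    by (auto simp: mat_mult_index_sum[of _ n n _ n] mat_adjoint_index[of _ M] carrier_matD[OF M]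
        simp del: index_mult_mat(1))
  finally show ?thesis
    by (simp add: M_def[symmetric] complex_norm_square ac_simps del: of_real_power)
qed

lemma mat_trace_diag_in:
  assumes "U \<in> carrier_mat n n" "mat_adjoint U * U = 1\<^sub>m n"
  shows "mat_trace (diag_in n U f) = (\<Sum>a<n. f a)"
proof -
  have "diag_in n U f * diag_in n U (\<lambda>_. 1) = diag_in n U f"
    by (simp add: diag_in_mult[OF assms])
  then have "mat_trace (diag_in n U f) = mat_trace (diag_in n U f * diag_in n U (\<lambda>_. 1))" by simp
  also have "\<dots> = (\<Sum>a<n. \<Sum>b<n. f a * 1 * of_real ((cmod (1\<^sub>m n $$ (a, b)))\<^sup>2))"
    unfolding mat_trace_diag_in_mult[OF assms(1,1)] assms(2) ..
  also have "\<dots> = (\<Sum>a<n. \<Sum>b<n. if a = b then f a else 0)"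
    by (intro sum.cong refl) auto
  finally show ?thesis by simp
qed

text \<open>The sums are diagonal entries of the products of W with its adjoint in the two orders.
  Thus the squared moduli of a unitary form a doubly stochastic matrix.\<close>

lemma unitary_overlap_sums:
  assumes "W \<in> carrier_mat n n" "mat_adjoint W * W = 1\<^sub>m n"
  shows "b < n \<Longrightarrow> (\<Sum>a<n. (cmod (W $$ (a, b)))\<^sup>2) = 1"
    and "a < n \<Longrightarrow> (\<Sum>b<n. (cmod (W $$ (a, b)))\<^sup>2) = 1"
proof -
  assume b: "b < n"
  have "(\<Sum>a<n. complex_of_real ((cmod (W $$ (a, b)))\<^sup>2)) = (mat_adjoint W * W) $$ (b, b)"
    using assms(1) b by (simp add: mat_mult_index_sum[of _ n n _ n] mat_adjoint_index complex_norm_square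
      mult.commute del: index_mult_mat(1) of_real_power)
  also have "\<dots> = 1" using assms b by simp
  finally show "(\<Sum>a<n. (cmod (W $$ (a, b)))\<^sup>2) = 1"
    by (metis of_real_eq_1_iff of_real_sum)
next
  assume a: "a < n"
  have "(\<Sum>b<n. complex_of_real ((cmod (W $$ (a, b)))\<^sup>2)) = (W * mat_adjoint W) $$ (a, a)"
    using assms(1) a by (simp add: mat_mult_index_sum[of _ n n _ n] mat_adjoint_index complex_norm_square
      del: index_mult_mat(1) of_real_power)
  also have "\<dots> = 1" using unitary_right[OF assms] a by simp
  finally show "(\<Sum>b<n. (cmod (W $$ (a, b)))\<^sup>2) = 1"
    by (metis of_real_eq_1_iff of_real_sum)
qed

section \<open>Rank and the number of nonzero eigenvalues\<close>

lemma rank_diag_in_le_card: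
  assumes "U \<in> carrier_mat n n" "finite S"
  shows "vec_space.rank n (diag_in n U (\<lambda>a. if a \<in> S then 1 else 0)) \<le> card S"
  using assms(2)
proof (induction S rule: finite_induct)
  case empty
  have "diag_in n U (\<lambda>_. 0) = 0\<^sub>m n n"
    using assms by (intro eq_matI) (auto simp: diag_in_index)
  then show ?case using vec_space.rank_0I[of n] by simp
next
  case (insert b S)
  let ?d = "\<lambda>S. diag_in n U (\<lambda>a. if a \<in> S then 1 else 0)"
  \<comment> \<open>Peeling off the index b leaves a matrix of rank at most one, and subadditivity
    of the rank closes the induction.\<close>
  have eq: "?d (insert b S) = ?d {b} + ?d S"
    unfolding diag_in_add[OF assms(1)] using insert.hyps by (intro diag_in_cong) auto
  have "vec_space.rank n (?d {b}) \<le> 1"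
  proof (rule vec_space.rank_le_1_product_entries)
    show "?d {b} \<in> carrier_mat n n" using assms by simp
    fix i j assume "i < dim_row (?d {b})" "j < dim_col (?d {b})"
    then have ij: "i < n" "j < n" using assms by auto
    have "?d {b} $$ (i, j) = (\<Sum>a<n. if a = b then U $$ (i, b) * cnj (U $$ (j, b)) else 0)"
      unfolding diag_in_index[OF assms(1) ij] by (intro sum.cong) auto
    then show "?d {b} $$ (i, j) = (if b < n then U $$ (i, b) else 0) * cnj (U $$ (j, b))" by simp
  qed
  moreover have "vec_space.rank n (?d (insert b S)) \<le> vec_space.rank n (?d {b}) + vec_space.rank n (?d S)"
    unfolding eq using assms by (intro vec_space.rank_subadditive) auto
  ultimately show ?case using insert by simp
qed

text \<open>Adding the projection onto the kernel, of rank at most the number of zero entries,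
  makes the matrix invertible.\<close>

lemma card_nonzero_le_rank_diag_in:
  assumes "U \<in> carrier_mat n n" "mat_adjoint U * U = 1\<^sub>m n"
  shows "card {a \<in> {..<n}. f a \<noteq> 0} \<le> vec_space.rank n (diag_in n U f)"
proof -
  define Z where "Z = {a \<in> {..<n}. f a = 0}"
  define g where "g a = (if a \<in> Z then 1 else f a)" for a
  let ?P = "diag_in n U (\<lambda>a. if a \<in> Z then 1 else 0)"
  have g: "diag_in n U f + ?P = diag_in n U g"
    unfolding diag_in_add[OF assms(1)] by (intro diag_in_cong) (auto simp: g_def Z_def)
  have "diag_in n U g * diag_in n U (\<lambda>a. 1 / g a) = diag_in n U (\<lambda>_. 1)"
    unfolding diag_in_mult[OF assms] by (rule diag_in_cong) (auto simp: g_def Z_def)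
  also have "\<dots> = 1\<^sub>m n" by (rule diag_in_one[OF assms])
  finally have "det (diag_in n U g) * det (diag_in n U (\<lambda>a. 1 / g a)) = 1"
    using assms det_mult[of "diag_in n U g" n "diag_in n U (\<lambda>a. 1 / g a)"] by simp
  then have "vec_space.rank n (diag_in n U g) = n"
    using assms by (intro vec_space.low_rank_det_zero) auto
  moreover have "vec_space.rank n (diag_in n U f + ?P)
      \<le> vec_space.rank n (diag_in n U f) + vec_space.rank n ?P"
    using assms by (intro vec_space.rank_subadditive) auto
  moreover have "vec_space.rank n ?P \<le> card Z"
    using assms by (intro rank_diag_in_le_card) (auto simp: Z_def)
  moreover have "card {a \<in> {..<n}. f a \<noteq> 0} + card Z = n"
  proof -
    have "card ({a \<in> {..<n}. f a \<noteq> 0} \<union> Z) = card {a \<in> {..<n}. f a \<noteq> 0} + card Z"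
      by (intro card_Un_disjoint) (auto simp: Z_def)
    moreover have "{a \<in> {..<n}. f a \<noteq> 0} \<union> Z = {..<n}" by (auto simp: Z_def)
    ultimately show ?thesis by simp
  qed
  ultimately show ?thesis unfolding g by linarith
qed

section \<open>Spectral data of quantum states\<close>

lemma quantum_state_spectral:
  assumes "quantum_state d \<rho>"
  obtains U and p :: "nat \<Rightarrow> real" where "U \<in> carrier_mat d d" "mat_adjoint U * U = 1\<^sub>m d"
    "\<rho> = diag_in d U (\<lambda>a. of_real (p a))" "\<And>a. a < d \<Longrightarrow> 0 \<le> p a" "(\<Sum>a<d. p a) = 1"
    "card {a \<in> {..<d}. p a \<noteq> 0} \<le> vec_space.rank d \<rho>"
proof -
  have \<rho>: "\<rho> \<in> carrier_mat d d" "mat_adjoint \<rho> = \<rho>" "mat_trace \<rho> = 1"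
    and pos: "\<And>v. v \<in> carrier_vec d \<Longrightarrow> 0 \<le> (\<rho> *\<^sub>v v) \<bullet>c v"
    using assms by (auto simp: quantum_state_def positive_semidefinite_def)
  obtain U e where U: "U \<in> carrier_mat d d" "mat_adjoint U * U = 1\<^sub>m d" and eq: "\<rho> = diag_in d U e"
    using hermitian_diagonalization[OF \<rho>(1,2)] by auto
  note assoc = assoc_mult_mat[of _ d d _ d _ d] mult_carrier_mat[of _ d d _ d]
  have U': "mat_adjoint U \<in> carrier_mat d d" using U by simp
  \<comment> \<open>Column a of U is a unit eigenvector, so \<open>e a\<close> is its Rayleigh
    quotient; the order on complex numbers makes it real as well as nonnegative.\<close>
  have e: "0 \<le> e a" if a: "a < d" for a
  proof -
    have "\<rho> * U = U * mat_diag d e * (mat_adjoint U * U)"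
      unfolding eq diag_in_def using U(1) U' by (simp add: assoc)
    then have "\<rho> * U = mat d d (\<lambda>(i, j). U $$ (i, j) * e j)"
      using U by (simp add: mat_diag_mult_right[OF U(1)])
    then have "col (\<rho> * U) a = e a \<cdot>\<^sub>v col U a"
      using U(1) a by (intro eq_vecI) auto
    moreover have "col (\<rho> * U) a = \<rho> *\<^sub>v col U a"
      using U(1) \<rho>(1) a by (intro col_mult2) auto
    ultimately have "\<rho> *\<^sub>v col U a = e a \<cdot>\<^sub>v col U a" by metis
    moreover have "col U a \<bullet>c col U a = 1"
    proof -
      have "col U a \<bullet>c col U a = (mat_adjoint U * U) $$ (a, a)"
        using U(1) a by (auto simp: mat_mult_index_sum[of _ d d _ d] mat_adjoint_index scalar_prod_def
          atLeast0LessThan mult.commute simp del: index_mult_mat(1) intro!: sum.cong)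
      then show ?thesis using U(2) a by simp
    qed
    moreover have c: "col U a \<in> carrier_vec d" using U(1) a by auto
    ultimately show ?thesis using pos[OF c] by simp
  qed
  define p where "p a = Re (e a)" for a
  have ep: "e a = of_real (p a)" if "a < d" for a
    using e[OF that] by (simp add: p_def less_eq_complex_def complex_eq_iff)
  have eq': "\<rho> = diag_in d U (\<lambda>a. of_real (p a))" unfolding eq using ep by (intro diag_in_cong)
  have "complex_of_real (\<Sum>a<d. p a) = 1"
    using \<rho>(3) unfolding eq' mat_trace_diag_in[OF U] by simp
  then have "(\<Sum>a<d. p a) = 1" by (metis of_real_eq_1_iff)
  moreover have "0 \<le> p a" if "a < d" for a
    using e[OF that] by (simp add: p_def less_eq_complex_def)
  moreover have "card {a \<in> {..<d}. p a \<noteq> 0} \<le> vec_space.rank d \<rho>"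
    using card_nonzero_le_rank_diag_in[OF U, of "\<lambda>a. of_real (p a)"] eq' by simp
  ultimately show ?thesis using that U eq' by blast
qed

text \<open>The overlap matrix of the two eigenbases is unitary, so its squared moduli give a doubly
  stochastic w. The problem is thereby reduced to the real data p, q and w.\<close>

lemma quantum_states_moments:
  assumes "quantum_state d \<rho>" "quantum_state d \<sigma>"
  obtains p q :: "nat \<Rightarrow> real" and w :: "nat \<Rightarrow> nat \<Rightarrow> real" where
    "\<And>a. a < d \<Longrightarrow> 0 \<le> p a" "(\<Sum>a<d. p a) = 1" "card {a \<in> {..<d}. p a \<noteq> 0} \<le> vec_space.rank d \<rho>"
    "\<And>b. b < d \<Longrightarrow> 0 \<le> q b" "(\<Sum>b<d. q b) = 1" "card {b \<in> {..<d}. q b \<noteq> 0} \<le> vec_space.rank d \<sigma>"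
    "\<And>a b. 0 \<le> w a b" "\<And>a. a < d \<Longrightarrow> (\<Sum>b<d. w a b) = 1" "\<And>b. b < d \<Longrightarrow> (\<Sum>a<d. w a b) = 1"
    "\<And>i. mat_trace (\<rho> ^\<^sub>m i) = of_real (\<Sum>a<d. p a ^ i)"
    "\<And>i. mat_trace (\<sigma> ^\<^sub>m i) = of_real (\<Sum>b<d. q b ^ i)"
    "\<And>i j. mat_trace (\<rho> ^\<^sub>m i * \<sigma> ^\<^sub>m j) = of_real (\<Sum>a<d. \<Sum>b<d. w a b * p a ^ i * q b ^ j)"
proof -
  obtain U p where U: "U \<in> carrier_mat d d" "mat_adjoint U * U = 1\<^sub>m d"
    and \<rho>: "\<rho> = diag_in d U (\<lambda>a. of_real (p a))"
    and p: "\<And>a. a < d \<Longrightarrow> 0 \<le> p a" "(\<Sum>a<d. p a) = 1" "card {a \<in> {..<d}. p a \<noteq> 0} \<le> vec_space.rank d \<rho>"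
    by (rule quantum_state_spectral[OF assms(1)]) (rule that)
  obtain V q where V: "V \<in> carrier_mat d d" "mat_adjoint V * V = 1\<^sub>m d"
    and \<sigma>: "\<sigma> = diag_in d V (\<lambda>a. of_real (q a))"
    and q: "\<And>a. a < d \<Longrightarrow> 0 \<le> q a" "(\<Sum>a<d. q a) = 1" "card {a \<in> {..<d}. q a \<noteq> 0} \<le> vec_space.rank d \<sigma>"
    by (rule quantum_state_spectral[OF assms(2)]) (rule that)
  define W where "W = mat_adjoint U * V"
  have W: "W \<in> carrier_mat d d" using U V by (simp add: W_def mult_carrier_mat[of _ d d _ d])
  have U': "mat_adjoint U \<in> carrier_mat d d" "mat_adjoint V \<in> carrier_mat d d" using U V by simp_all
  have "mat_adjoint W * W = mat_adjoint V * ((U * mat_adjoint U) * V)"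
    using U(1) V(1) U' by (simp add: W_def mat_adjoint_mult[of _ d d _ d] assoc_mult_mat[of _ d d _ d _ d]
        mult_carrier_mat[of _ d d _ d])
  then have WW: "mat_adjoint W * W = 1\<^sub>m d"
    using V by (simp add: unitary_right[OF U])
  define w where "w a b = (cmod (W $$ (a, b)))\<^sup>2" for a b
  have tr: "mat_trace (diag_in d X (\<lambda>a. of_real (r a)) ^\<^sub>m i) = of_real (\<Sum>a<d. r a ^ i)"
    if "X \<in> carrier_mat d d" "mat_adjoint X * X = 1\<^sub>m d" for X i and r :: "nat \<Rightarrow> real"
    by (simp add: diag_in_pow[OF that] mat_trace_diag_in[OF that])
  show ?thesis
  proof (rule that[of p q w])
    show "0 \<le> w a b" for a b by (simp add: w_def)
    show "(\<Sum>b<d. w a b) = 1" if "a < d" for a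
      unfolding w_def using that by (rule unitary_overlap_sums[OF W WW])
    show "(\<Sum>a<d. w a b) = 1" if "b < d" for b
      unfolding w_def using that by (rule unitary_overlap_sums[OF W WW])
    show "mat_trace (\<rho> ^\<^sub>m i) = of_real (\<Sum>a<d. p a ^ i)" for i unfolding \<rho> by (rule tr[OF U])
    show "mat_trace (\<sigma> ^\<^sub>m i) = of_real (\<Sum>b<d. q b ^ i)" for i unfolding \<sigma> by (rule tr[OF V])
    show "mat_trace (\<rho> ^\<^sub>m i * \<sigma> ^\<^sub>m j) = of_real (\<Sum>a<d. \<Sum>b<d. w a b * p a ^ i * q b ^ j)" for i j
      unfolding \<rho> \<sigma> diag_in_pow[OF U] diag_in_pow[OF V] mat_trace_diag_in_mult[OF U(1) V(1)]
      by (simp add: w_def W_def ac_simps)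
  qed (use p q in auto)
qed

section \<open>Accuracy of the estimator\<close>

text \<open>Bounding q_b^j by 1 and p_a^i by p_a leaves the row sums of w, hence the sum of
  p.\<close>

lemma mixed_moment_le_1:
  fixes p :: "'a \<Rightarrow> real" and q :: "'b \<Rightarrow> real"
  assumes "finite S" "finite T" "\<And>a b. 0 \<le> w a b" "\<And>a. a \<in> S \<Longrightarrow> (\<Sum>b\<in>T. w a b) = 1"
    and "\<And>a. a \<in> S \<Longrightarrow> 0 \<le> p a" "sum p S = 1" "\<And>b. b \<in> T \<Longrightarrow> 0 \<le> q b" "sum q T = 1" "1 \<le> i"
  shows "\<bar>\<Sum>a\<in>S. \<Sum>b\<in>T. w a b * p a ^ i * q b ^ j\<bar> \<le> 1"
proof -
  have p1: "p a \<le> 1" if "a \<in> S" for a using member_le_sum[of a S p] assms that by simp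
  have q1: "q b \<le> 1" if "b \<in> T" for b using member_le_sum[of b T q] assms that by simp
  have "(\<Sum>a\<in>S. \<Sum>b\<in>T. w a b * p a ^ i * q b ^ j) \<le> (\<Sum>a\<in>S. \<Sum>b\<in>T. w a b * p a * 1)"
    using assms p1 q1
    by (intro sum_mono mult_mono power_le_self power_le_one mult_nonneg_nonneg) auto
  also have "\<dots> = (\<Sum>a\<in>S. p a)" by (simp add: sum_distrib_right[symmetric] assms)
  finally have "(\<Sum>a\<in>S. \<Sum>b\<in>T. w a b * p a ^ i * q b ^ j) \<le> 1" using assms by simp
  moreover have "0 \<le> (\<Sum>a\<in>S. \<Sum>b\<in>T. w a b * p a ^ i * q b ^ j)"
    using assms by (intro sum_nonneg mult_nonneg_nonneg) auto
  ultimately show ?thesis by simp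
qed

lemma moment_estimate_accurate:
  fixes p :: "'a \<Rightarrow> real" and q :: "'b \<Rightarrow> real" and \<epsilon> :: real
  assumes fin: "finite S" "finite T"
    and w: "\<And>a b. 0 \<le> w a b" "\<And>a. a \<in> S \<Longrightarrow> (\<Sum>b\<in>T. w a b) = 1" "\<And>b. b \<in> T \<Longrightarrow> (\<Sum>a\<in>S. w a b) = 1"
    and p: "\<And>a. a \<in> S \<Longrightarrow> 0 \<le> p a" "sum p S = 1" "card {a\<in>S. p a \<noteq> 0} \<le> r"
    and q: "\<And>b. b \<in> T \<Longrightarrow> 0 \<le> q b" "sum q T = 1" "card {b\<in>T. q b \<noteq> 0} \<le> r"
    and R: "1 \<le> R_tilde k l \<epsilon> r" "R_tilde k l \<epsilon> r < int k" "R_tilde k l \<epsilon> r < int l"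
      "R_tilde k l \<epsilon> r \<le> int t"
    and \<epsilon>: "0 < \<epsilon>" "\<epsilon> < 1" and ij: "i \<in> {1..k}" "j \<in> {1..l}"
  shows "\<bar>moment_estimate t (\<lambda>i. \<Sum>a\<in>S. p a ^ i) (\<lambda>i. \<Sum>b\<in>T. q b ^ i)
      (\<lambda>i j. \<Sum>a\<in>S. \<Sum>b\<in>T. w a b * p a ^ i * q b ^ j) i j
    - (\<Sum>a\<in>S. \<Sum>b\<in>T. w a b * p a ^ i * q b ^ j)\<bar> \<le> 3 / 4 * \<epsilon>"
proof (cases "r \<le> t")
  case True
  have "reduced_power t (fps_nth (esym_fps S p)) i (p a) = p a ^ i" if "a \<in> S" for a
    using fin p True ij that by (intro reduced_power_exact) auto
  moreover have "reduced_power t (fps_nth (esym_fps T q)) j (q b) = q b ^ j" if "b \<in> T" for b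
    using fin q True ij that by (intro reduced_power_exact) auto
  ultimately show ?thesis using \<epsilon> by (simp add: moment_estimate_eq[OF fin])
next
  case False
  \<comment> \<open>Since t < r and the minimum is at most t, it is attained by the logarithmic
    term.\<close>
  then have "R_tilde k l \<epsilon> r = \<lceil>ln ((4 * real k + 4 * real l) / \<epsilon>)\<rceil>"
    using R(4) by (auto simp: R_tilde_def min_def split: if_splits)
  note b = truncation_order_bounds[OF \<epsilon> R[unfolded this]]
  have p1: "p a \<le> 1" if "a \<in> S" for a using member_le_sum[of a S p] fin p that by simp
  have q1: "q b \<le> 1" if "b \<in> T" for b using member_le_sum[of b T q] fin q that by simp
  \<comment> \<open>The common order N = k + l covers both i <= k and j <= l. The error has the form
    \<tau> p_a with \<tau> = 2 / t!.\<close>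
  have px: "\<bar>p a ^ i - reduced_power t (fps_nth (esym_fps S p)) i (p a)\<bar> \<le> 2 / fact t * p a"
    if "a \<in> S" for a
    using reduced_power_error_le[of S a p t "k + l" i] fin p b ij that by simp
  have qx: "\<bar>q a ^ j - reduced_power t (fps_nth (esym_fps T q)) j (q a)\<bar> \<le> 2 / fact t * q a"
    if "a \<in> T" for a
    using reduced_power_error_le[of T a q t "k + l" j] fin q b ij that by simp
  have "\<bar>(\<Sum>a\<in>S. \<Sum>b\<in>T. w a b * reduced_power t (fps_nth (esym_fps S p)) i (p a)
         * reduced_power t (fps_nth (esym_fps T q)) j (q b))
      - (\<Sum>a\<in>S. \<Sum>b\<in>T. w a b * p a ^ i * q b ^ j)\<bar> \<le> 2 * (2 / fact t) + (2 / fact t)\<^sup>2"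
    using fin w p q p1 q1
    by (intro weighted_product_error[OF _ _ _ _ _ _ _ _ _ _ _ px _ qx]) (auto simp: power_le_one)
  then show ?thesis using b(3) by (simp add: moment_estimate_eq[OF fin])
qed

theorem theorem5p2:
  fixes k l t :: nat and \<epsilon> :: real
  assumes "k \<ge> 1" and "l \<ge> 1" and "\<epsilon> > 0"
  shows "\<exists>\<eta> > 0. \<exists>F :: procedure.
    \<forall>(d :: nat) (\<rho> :: complex mat) (\<sigma> :: complex mat) (r :: nat).
      quantum_state d \<rho> \<longrightarrow> quantum_state d \<sigma> \<longrightarrow>
      r = max (vec_space.rank d \<rho>) (vec_space.rank d \<sigma>) \<longrightarrow>
      1 \<le> R_tilde k l \<epsilon> r \<longrightarrow> R_tilde k l \<epsilon> r < int k \<longrightarrow> R_tilde k l \<epsilon> r < int l \<longrightarrow>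
      R_tilde k l \<epsilon> r \<le> int t \<longrightarrow>
      (\<forall>a b c.
        (\<forall>i \<in> {1..t}. cmod (a i - mat_trace (\<rho> ^\<^sub>m i)) \<le> \<eta>) \<longrightarrow>
        (\<forall>i \<in> {1..t}. cmod (b i - mat_trace (\<sigma> ^\<^sub>m i)) \<le> \<eta>) \<longrightarrow>
        (\<forall>i \<in> {1..t}. \<forall>j \<in> {1..t}. cmod (c i j - mat_trace (\<rho> ^\<^sub>m i * \<sigma> ^\<^sub>m j)) \<le> \<eta>) \<longrightarrow>
        (\<forall>i \<in> {1..k}. \<forall>j \<in> {1..l}.
          cmod (F a b c i j - mat_trace (\<rho> ^\<^sub>m i * \<sigma> ^\<^sub>m j)) \<le> \<epsilon>))"
proof (cases "\<epsilon> < 1")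
  case False
  \<comment> \<open>For \<epsilon> >= 1 the constant output 0 is good enough, since the relevant
    mixed moments have absolute value at most 1.\<close>
  show ?thesis
  proof (intro exI[of _ 1] exI[of _ "\<lambda>_ _ _ _ _. 0"] conjI allI impI ballI)
    fix d \<rho> \<sigma> i j
    assume st: "quantum_state d \<rho>" "quantum_state d \<sigma>" and i: "i \<in> {1..k}"
    obtain p q w where m:
      "\<And>a. a < d \<Longrightarrow> 0 \<le> p a" "(\<Sum>a<d. p a) = 1" "card {a \<in> {..<d}. p a \<noteq> 0} \<le> vec_space.rank d \<rho>"
      "\<And>b. b < d \<Longrightarrow> 0 \<le> q b" "(\<Sum>b<d. q b) = 1" "card {b \<in> {..<d}. q b \<noteq> 0} \<le> vec_space.rank d \<sigma>"
      "\<And>a b. 0 \<le> w a b" "\<And>a. a < d \<Longrightarrow> (\<Sum>b<d. w a b) = 1" "\<And>b. b < d \<Longrightarrow> (\<Sum>a<d. w a b) = 1"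
      "\<And>i. mat_trace (\<rho> ^\<^sub>m i) = of_real (\<Sum>a<d. p a ^ i)"
      "\<And>i. mat_trace (\<sigma> ^\<^sub>m i) = of_real (\<Sum>b<d. q b ^ i)"
      "\<And>i j. mat_trace (\<rho> ^\<^sub>m i * \<sigma> ^\<^sub>m j) = of_real (\<Sum>a<d. \<Sum>b<d. w a b * p a ^ i * q b ^ j)"
      by (rule quantum_states_moments[OF st]) (rule that)
    have "\<bar>\<Sum>a<d. \<Sum>b<d. w a b * p a ^ i * q b ^ j\<bar> \<le> 1"
      using m i by (intro mixed_moment_le_1) auto
    then show "cmod (0 - mat_trace (\<rho> ^\<^sub>m i * \<sigma> ^\<^sub>m j)) \<le> \<epsilon>"
      using False by (simp only: m(12) diff_0 norm_minus_cancel norm_of_real)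
  qed auto
next
  case True
  \<comment> \<open>The tolerance is fixed before any state is introduced. Noise may cost \<epsilon>
    / 4; the other 3/4 \<epsilon> is the error of the estimator on exact data.\<close>
  obtain \<eta> where \<eta>: "0 < \<eta>" and stable: "\<And>P Q C P' Q' C' i j.
    (\<forall>m\<in>{1..t}. \<bar>P' m\<bar> \<le> 1 \<and> \<bar>Q' m\<bar> \<le> 1 \<and> \<bar>P m - P' m\<bar> \<le> \<eta> \<and> \<bar>Q m - Q' m\<bar> \<le> \<eta>) \<Longrightarrow>
    (\<forall>m\<in>{1..t}. \<forall>n\<in>{1..t}. \<bar>C' m n\<bar> \<le> 1 \<and> \<bar>C m n - C' m n\<bar> \<le> \<eta>) \<Longrightarrow> i \<in> {1..k} \<Longrightarrow> j \<in> {1..l} \<Longrightarrow>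
    \<bar>moment_estimate t P Q C i j - moment_estimate t P' Q' C' i j\<bar> < \<epsilon> / 4"
    using moment_estimate_stable[of "{1..k}" "{1..l}" "\<epsilon> / 4" t] assms(3) by (force simp del: One_nat_def)
  \<comment> \<open>The true moments are real, so replacing a complex estimate by its real part does
    not increase the error.\<close>
  define F :: procedure where
    "F a b c i j = of_real (moment_estimate t (\<lambda>m. Re (a m)) (\<lambda>m. Re (b m)) (\<lambda>m n. Re (c m n)) i j)"
    for a b c i j
  have Re_close: "\<bar>Re z - x\<bar> \<le> \<eta>" if "cmod (z - of_real x) \<le> \<eta>" for z x
    using abs_Re_le_cmod[of "z - of_real x"] that by simp
  show ?thesis
  proof (intro exI[of _ \<eta>] exI[of _ F] conjI allI impI ballI \<eta>)
    fix d \<rho> \<sigma> r a b c i j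
    assume st: "quantum_state d \<rho>" "quantum_state d \<sigma>"
      and r: "r = max (vec_space.rank d \<rho>) (vec_space.rank d \<sigma>)"
      and R: "1 \<le> R_tilde k l \<epsilon> r" "R_tilde k l \<epsilon> r < int k" "R_tilde k l \<epsilon> r < int l"
        "R_tilde k l \<epsilon> r \<le> int t"
      and abc: "\<forall>i \<in> {1..t}. cmod (a i - mat_trace (\<rho> ^\<^sub>m i)) \<le> \<eta>"
        "\<forall>i \<in> {1..t}. cmod (b i - mat_trace (\<sigma> ^\<^sub>m i)) \<le> \<eta>"
        "\<forall>i \<in> {1..t}. \<forall>j \<in> {1..t}. cmod (c i j - mat_trace (\<rho> ^\<^sub>m i * \<sigma> ^\<^sub>m j)) \<le> \<eta>"
      and ij: "i \<in> {1..k}" "j \<in> {1..l}"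
    obtain p q w where m:
      "\<And>a. a < d \<Longrightarrow> 0 \<le> p a" "(\<Sum>a<d. p a) = 1" "card {a \<in> {..<d}. p a \<noteq> 0} \<le> vec_space.rank d \<rho>"
      "\<And>b. b < d \<Longrightarrow> 0 \<le> q b" "(\<Sum>b<d. q b) = 1" "card {b \<in> {..<d}. q b \<noteq> 0} \<le> vec_space.rank d \<sigma>"
      "\<And>a b. 0 \<le> w a b" "\<And>a. a < d \<Longrightarrow> (\<Sum>b<d. w a b) = 1" "\<And>b. b < d \<Longrightarrow> (\<Sum>a<d. w a b) = 1"
      "\<And>i. mat_trace (\<rho> ^\<^sub>m i) = of_real (\<Sum>a<d. p a ^ i)"
      "\<And>i. mat_trace (\<sigma> ^\<^sub>m i) = of_real (\<Sum>b<d. q b ^ i)"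
      "\<And>i j. mat_trace (\<rho> ^\<^sub>m i * \<sigma> ^\<^sub>m j) = of_real (\<Sum>a<d. \<Sum>b<d. w a b * p a ^ i * q b ^ j)"
      by (rule quantum_states_moments[OF st]) (rule that)
    define P where "P = (\<lambda>i. \<Sum>a<d. p a ^ i)"
    define Q where "Q = (\<lambda>i. \<Sum>b<d. q b ^ i)"
    define C where "C = (\<lambda>i j. \<Sum>a<d. \<Sum>b<d. w a b * p a ^ i * q b ^ j)"
    have tr: "mat_trace (\<rho> ^\<^sub>m i) = of_real (P i)" "mat_trace (\<sigma> ^\<^sub>m i) = of_real (Q i)"
      "mat_trace (\<rho> ^\<^sub>m i * \<sigma> ^\<^sub>m j) = of_real (C i j)" for i j
      by (simp_all only: m(10-12) P_def Q_def C_def)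
    have "\<bar>P m\<bar> \<le> 1" "\<bar>Q m\<bar> \<le> 1" if "m \<in> {1..t}" for m
      unfolding P_def Q_def using m that by (auto intro!: power_sum_le_1)
    moreover have "\<bar>C m n\<bar> \<le> 1" if "m \<in> {1..t}" for m n
      unfolding C_def using m that by (intro mixed_moment_le_1) auto
    ultimately have 1: "\<bar>moment_estimate t (\<lambda>m. Re (a m)) (\<lambda>m. Re (b m)) (\<lambda>m n. Re (c m n)) i j
        - moment_estimate t P Q C i j\<bar> < \<epsilon> / 4"
      using abc ij unfolding tr by (intro stable ballI conjI Re_close) auto
    have 2: "\<bar>moment_estimate t P Q C i j - C i j\<bar> \<le> 3 / 4 * \<epsilon>"
      unfolding P_def Q_def C_def
      by (rule moment_estimate_accurate[where r = r]) (use m r R True assms(3) ij in auto)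
    have "F a b c i j - mat_trace (\<rho> ^\<^sub>m i * \<sigma> ^\<^sub>m j)
        = of_real (moment_estimate t (\<lambda>m. Re (a m)) (\<lambda>m. Re (b m)) (\<lambda>m n. Re (c m n)) i j - C i j)"
      by (simp add: F_def tr)
    then show "cmod (F a b c i j - mat_trace (\<rho> ^\<^sub>m i * \<sigma> ^\<^sub>m j)) \<le> \<epsilon>"
      using 1 2 by (simp only: norm_of_real)
  qed
qed

end
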